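(* For integers $m,n$ with $\min(m,n)\ge 4$, the number of vertices of degree $5$ in $\mathrm{OFG}(M_{m,n})$ is \[ \tfrac13\bigl(2m^3+2n^3+6m^2+6n^2+150mn-392m-392n+792\bigr). \]
   Context: $G_{m,n}$ is the grid graph with vertex set $\{(i,j): 1\le i\le m,\ 1\le j\le n\}$, each vertex joined to its horizontal and vertical neighbours. A proper $3$-colouring is a map $c:V(G_{m,n})\to\mathbb{Z}/3\mathbb{Z}$ with $c(u)\ne c(v)$ for every edge $uv$. $\mathrm{OFG}(M_{m,n})$ is the origami flip graph of the $m\times n$ Miura-ori (vertices: flat-foldable mountain--valley assignments; edges: single face flips). Throughout it is identified, by a known bijection, with the following simple graph: its vertices are the orbits of proper $3$-colourings of $G_{m,n}$ under the global colour rotation $c\mapsto c+1$ (action of $\mathbb{Z}/3\mathbb{Z}$), and two distinct orbits are adjacent if and only if they contain representatives that differ at exactly one vertex of $G_{m,n}$. *)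

theory Defs
  imports Complex_Main "HOL-Library.FuncSet" "HOL-Library.Numeral_Type"
begin

definition grid_verts :: "nat \<Rightarrow> nat \<Rightarrow> (nat \<times> nat) set" where
  "grid_verts m n = {1..m} \<times> {1..n}"

definition grid_adj :: "nat \<Rightarrow> nat \<Rightarrow> nat \<times> nat \<Rightarrow> nat \<times> nat \<Rightarrow> bool" where
  "grid_adj m n u v \<longleftrightarrow> u \<in> grid_verts m n \<and> v \<in> grid_verts m n \<and>
     (fst u = fst v \<and> (snd v = snd u + 1 \<or> snd u = snd v + 1) \<or>
      snd u = snd v \<and> (fst v = fst u + 1 \<or> fst u = fst v + 1))"

text \<open>The numeral type \<open>3\<close> is the ring of integers modulo 3.  Colourings are
  extensional functions, so that each map on the grid is represented exactly once.\<close>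

type_synonym colouring = "nat \<times> nat \<Rightarrow> 3"

definition proper_colourings :: "nat \<Rightarrow> nat \<Rightarrow> colouring set" where
  "proper_colourings m n =
     {c \<in> grid_verts m n \<rightarrow>\<^sub>E UNIV. \<forall>u v. grid_adj m n u v \<longrightarrow> c u \<noteq> c v}"

definition rotate_colouring :: "nat \<Rightarrow> nat \<Rightarrow> 3 \<Rightarrow> colouring \<Rightarrow> colouring" where
  "rotate_colouring m n k c = (\<lambda>v \<in> grid_verts m n. c v + k)"

definition rotation_orbit :: "nat \<Rightarrow> nat \<Rightarrow> colouring \<Rightarrow> colouring set" where
  "rotation_orbit m n c = range (\<lambda>k. rotate_colouring m n k c)"

text \<open>The origami flip graph of the Miura-ori, under its identification with the graph
  of proper 3-colourings of the grid modulo global colour rotation.\<close>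

definition OFG_verts :: "nat \<Rightarrow> nat \<Rightarrow> colouring set set" where
  "OFG_verts m n = rotation_orbit m n ` proper_colourings m n"

definition OFG_adj :: "nat \<Rightarrow> nat \<Rightarrow> colouring set \<Rightarrow> colouring set \<Rightarrow> bool" where
  "OFG_adj m n A B \<longleftrightarrow> A \<in> OFG_verts m n \<and> B \<in> OFG_verts m n \<and> A \<noteq> B \<and>
     (\<exists>c \<in> A. \<exists>d \<in> B. \<exists>!v. v \<in> grid_verts m n \<and> c v \<noteq> d v)"

definition OFG_degree :: "nat \<Rightarrow> nat \<Rightarrow> colouring set \<Rightarrow> nat" where
  "OFG_degree m n A = card {B. OFG_adj m n A B}"

end

theory Submission
  imports Defs "HOL-Library.Sublist"
begin

text \<open>Reading colour differences as steps up or down turns a colouring, up to rotation, into a pair of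
  sign patterns on the horizontal and vertical edges; the degree of its orbit is the number \<open>E\<close> of local
  extrema.  Each unit square either has equal signs on opposite edges or is alternating.  Counting sign
  changes at the corners of the squares (a discrete Euler formula) gives \<open>2E \<ge> 2F + 2 + e\<close>, where \<open>F\<close> is
  the number of alternating squares and \<open>e\<close> the number of direction changes along the boundary.  One
  alternating square forces \<open>e \<ge> 3\<close>, so \<open>E = 5\<close> leaves only \<open>F \<le> 2\<close>, and \<open>F = 2\<close> only if the two squares
  touch diagonally and have the same type.  In each of the three cases the pattern is determined by a few sign
  words and \<open>E\<close> is a sum of products of numbers of ascents and descents of these words, which depend
  only on the first letter and the number of changes of each word; so the patterns can be counted.\<close>

section \<open>Ascents, descents and changes of binary words\<close>

text \<open>The steps around a unit square are four signs that cancel modulo 3. Two signs sum to -2,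
  0 or 2, which are distinct modulo 3, so they already cancel as integers: a colouring is the
  residue of an integer height function, and a square has only the two shapes. A vertex can be
  recoloured on its own exactly when its neighbours share one colour, that is, at a strict local
  extremum of the heights. The obstacle is that few extrema do not by themselves confine the
  pattern: the position of an alternating square is free and the words around it can be long. The
  Euler inequality bounds the number of squares; for a given number of squares, \<open>E\<close>
  grows at least linearly in the number of changes of the words, so only finitely many classes of
  words survive. The size of a class is a binomial coefficient, because changes and positions are
  choices of gaps in a line; this is how the cubic polynomial arises. The boundary word is cut open
  at one corner, so its count of changes need not be even: hence the bound 3, where a closed walk
  would give 4.\<close>

fun asc :: "bool list \<Rightarrow> nat" where
  "asc (x # y # zs) = of_bool (\<not> x \<and> y) + asc (y # zs)"
| "asc [x] = 0" | "asc [] = 0"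

fun desc :: "bool list \<Rightarrow> nat" where
  "desc (x # y # zs) = of_bool (x \<and> \<not> y) + desc (y # zs)"
| "desc [x] = 0" | "desc [] = 0"

definition chg :: "bool list \<Rightarrow> nat" where "chg xs = asc xs + desc xs"

lemma chg_simps [simp]: "chg [] = 0" "chg [x] = 0"
  "chg (x # y # zs) = of_bool (x \<noteq> y) + chg (y # zs)"
  by (auto simp: chg_def)

text \<open>Ascents and descents alternate, and the first letter decides which kind comes
  first.\<close>

lemma asc_eq: "asc (x # xs) = (chg (x # xs) + of_bool (\<not> x)) div 2"
  and desc_eq: "desc (x # xs) = (chg (x # xs) + of_bool x) div 2"
proof (induction xs arbitrary: x)
  case (Cons y ys)
  { case 1 then show ?case using Cons[of y] by (cases x; cases y) auto }
  { case 2 then show ?case using Cons[of y] by (cases x; cases y) auto }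
qed simp_all

lemma chg_append: "xs \<noteq> [] \<Longrightarrow> ys \<noteq> [] \<Longrightarrow>
  chg (xs @ ys) = chg xs + of_bool (last xs \<noteq> hd ys) + chg ys"
proof (induction xs rule: induct_list012)
  case (2 x) then show ?case by (cases ys) auto
qed auto

lemma chg_rev: "chg (rev xs) = chg xs"
proof (induction xs rule: induct_list012)
  case (3 x y zs)
  then show ?case using chg_append[of "rev zs @ [y]" "[x]"] by (auto simp: of_bool_def)
qed auto

lemma chg_map_Not: "chg (map Not xs) = chg xs"
  by (induction xs rule: induct_list012) auto

lemma chg_map_upt: "chg (map f [0..<k]) = (\<Sum>i\<in>{1..<k}. of_bool (f (i - 1) \<noteq> f i))"
proof (induction k)
  case (Suc k)
  show ?case
  proof (cases "k = 0")
    case False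
    then have "chg (map f [0..<k] @ [f k]) = chg (map f [0..<k]) + of_bool (f (k - 1) \<noteq> f k)"
      using chg_append[of "map f [0..<k]" "[f k]"] by (auto simp: last_map)
    with Suc False show ?thesis by simp
  qed simp
qed simp

lemma chg_Cons_le: "chg (x # ys) \<le> chg (x # y # ys)" "chg ys \<le> chg (x # ys)"
  by (cases ys; auto)+

text \<open>Deleting letters never creates changes. The version with a letter \<open>z\<close> in
  front is what the induction needs; the plain one later bounds boundary words from below by a few
  sampled letters.\<close>

lemma chg_subseq: "subseq xs ys \<Longrightarrow> chg (z # xs) \<le> chg (z # ys) \<and> chg xs \<le> chg ys"
proof (induction arbitrary: z rule: list_emb.induct)
  case (list_emb_Nil ys)
  then show ?case by simp
next
  case (list_emb_Cons xs ys y)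
  then show ?case by (meson chg_Cons_le le_trans)
next
  case (list_emb_Cons2 x y xs ys)
  then show ?case by simp
qed

lemma last_eq: "xs \<noteq> [] \<Longrightarrow> last xs = (hd xs \<noteq> odd (chg xs))"
  by (induction xs rule: induct_list012) auto

lemma desc_sum: "desc xs = (\<Sum>i<length xs - 1. of_bool (xs ! i \<and> \<not> xs ! Suc i))"
  by (induction xs rule: desc.induct) (simp_all add: sum.lessThan_Suc_shift del: sum.lessThan_Suc sum_of_bool_eq)

lemma asc_sum: "asc xs = (\<Sum>i<length xs - 1. of_bool (\<not> xs ! i \<and> xs ! Suc i))"
  by (induction xs rule: asc.induct) (simp_all add: sum.lessThan_Suc_shift del: sum.lessThan_Suc sum_of_bool_eq)

text \<open>The first letter and the set of those of the \<open>k\<close> gaps at which the letter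
  changes determine the word; splitting on the second letter gives Pascal's rule.\<close>

lemma card_words: "card {x. length x = Suc k \<and> hd x = h \<and> chg x = c} = k choose c"
proof (induction k arbitrary: h c)
  case 0
  have "{x. length x = Suc 0 \<and> hd x = h \<and> chg x = c} = (if c = 0 then {[h]} else {})"
    by (auto simp: length_Suc_conv)
  then show ?case by (simp del: not_None_eq split: if_splits)
next
  case (Suc k)
  let ?S = "\<lambda>k h c. {x. length x = Suc k \<and> hd x = h \<and> chg x = c}"
  have fin: "finite (?S k h c)" for k h c
    by (rule finite_subset[OF _ finite_lists_length_eq[of UNIV "Suc k"]]) auto
  have eq: "?S (Suc k) h c = (#) h ` ?S k h c \<union> (if c = 0 then {} else (#) h ` ?S k (\<not> h) (c - 1))"
  proof (intro equalityI subsetI)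
    fix x assume "x \<in> ?S (Suc k) h c"
    then obtain g zs where "x = h # g # zs" "length zs = k" "of_bool (h \<noteq> g) + chg (g # zs) = c"
      by (auto simp: length_Suc_conv)
    then show "x \<in> (#) h ` ?S k h c \<union> (if c = 0 then {} else (#) h ` ?S k (\<not> h) (c - 1))"
      by (cases "h = g") (auto intro!: image_eqI)
  next
    fix x assume "x \<in> (#) h ` ?S k h c \<union> (if c = 0 then {} else (#) h ` ?S k (\<not> h) (c - 1))"
    then show "x \<in> ?S (Suc k) h c"
      by (auto simp: length_Suc_conv split: if_splits)
  qed
  have "card (?S (Suc k) h c) = card ((#) h ` ?S k h c) + (if c = 0 then 0 else card ((#) h ` ?S k (\<not> h) (c - 1)))"
    unfolding eq by (subst card_Un_disjoint) (auto simp: fin)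
  also have "\<dots> = Suc k choose c"
    using Suc.IH by (cases c) (auto simp: card_image)
  finally show ?case .
qed

text \<open>The number of extrema of a pattern with exactly one alternating square: \<open>u\<close> and \<open>d\<close> are the sign words
  above and below the square, \<open>l\<close> and \<open>w\<close> those to its left and right, with signs relative to the type
  of the square.  The four lines are the quadrants around the square; in each, the first product counts
  maxima and the second minima.  The padding letters at the outer ends make boundary vertices behave like
  interior ones.\<close>

definition quad :: "bool list \<Rightarrow> bool list \<Rightarrow> bool list \<Rightarrow> bool list \<Rightarrow> nat" where
  "quad u d l w =
     desc (True # u @ [True]) * desc (True # l @ [True]) + asc (False # u @ [True]) * asc (False # l @ [True])
   + desc (True # u @ [False]) * desc (True # w @ [False]) + asc (False # u @ [False]) * asc (True # w @ [True])
   + desc (True # d @ [False]) * desc (True # l @ [False]) + asc (True # d @ [True]) * asc (False # l @ [False])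
   + desc (False # d @ [False]) * desc (False # w @ [False]) + asc (False # d @ [True]) * asc (False # w @ [True])"

text \<open>The first letter and the number of changes determine all padded ascent and descent counts.\<close>

definition wcls :: "bool list \<Rightarrow> (bool \<times> nat) option" where
  "wcls x = (if x = [] then None else Some (hd x, chg x))"

text \<open>The last letter is \<open>h\<close> negated \<open>k\<close> times, so
  \<open>h = (odd k = z)\<close> says that it differs from the closing letter
  \<open>z\<close>.\<close>

fun pad_chg :: "bool \<Rightarrow> (bool \<times> nat) option \<Rightarrow> bool \<Rightarrow> nat" where
  "pad_chg y None z = of_bool (y \<noteq> z)"
| "pad_chg y (Some (h, k)) z = of_bool (y \<noteq> h) + k + of_bool (h = (odd k = z))"

lemma pad_chg: "chg (y # x @ [z]) = pad_chg y (wcls x) z"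
proof (cases "x = []")
  case False
  have "chg ((y # x) @ [z]) = chg (y # x) + of_bool (last x \<noteq> z)"
    using False by (subst chg_append) auto
  moreover have "chg (y # x) = of_bool (y \<noteq> hd x) + chg x"
    using False by (cases x) auto
  moreover have "(last x \<noteq> z) = (hd x = (odd (chg x) = z))"
    using last_eq[OF False] by blast
  ultimately have "chg (y # x @ [z]) = of_bool (y \<noteq> hd x) + chg x + of_bool (hd x = (odd (chg x) = z))"
    by (simp only: append_Cons)
  then show ?thesis unfolding wcls_def if_not_P[OF False] pad_chg.simps .
qed (simp add: wcls_def)

definition cdesc :: "bool \<Rightarrow> (bool \<times> nat) option \<Rightarrow> bool \<Rightarrow> nat" where
  "cdesc y x z = (pad_chg y x z + of_bool y) div 2"
definition casc :: "bool \<Rightarrow> (bool \<times> nat) option \<Rightarrow> bool \<Rightarrow> nat" where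
  "casc y x z = (pad_chg y x z + of_bool (\<not> y)) div 2"

lemma desc_wcls: "desc (y # x @ [z]) = cdesc y (wcls x) z"
  and asc_wcls: "asc (y # x @ [z]) = casc y (wcls x) z"
  by (simp_all add: desc_eq asc_eq cdesc_def casc_def pad_chg)

fun cquad where
  "cquad ((u, d), (l, w)) =
     cdesc True u True * cdesc True l True + casc False u True * casc False l True
   + cdesc True u False * cdesc True w False + casc False u False * casc True w True
   + cdesc True d False * cdesc True l False + casc True d True * casc False l False
   + cdesc False d False * cdesc False w False + casc False d True * casc False w True"

lemma quad_wcls: "quad u d l w = cquad ((wcls u, wcls d), (wcls l, wcls w))"
  by (simp add: quad_def desc_wcls asc_wcls)

text \<open>Padding with \<open>False\<close> in front and \<open>True\<close> behind adds no
  descent, and a word leading from \<open>False\<close> to \<open>True\<close> has one ascent more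
  than descents; dually for the other padding.\<close>

lemma pad_asc_desc:
  "asc (False # x @ [True]) = Suc (desc x)" "desc (True # x @ [False]) = Suc (asc x)"
proof -
  have "asc (False # x @ [True]) = Suc (desc x) \<and> desc (True # x @ [False]) = Suc (asc x)"
  proof (cases x)
    case (Cons h t)
    have c: "chg (y # x @ [z]) = of_bool (y \<noteq> h) + chg x + of_bool (h = (odd (chg x) = z))" for y z
      unfolding pad_chg wcls_def Cons by (simp only: list.distinct if_False pad_chg.simps list.sel)
    show ?thesis unfolding asc_eq desc_eq c unfolding Cons asc_eq desc_eq
      by (cases h; cases "odd (chg (h # t))") (auto elim!: oddE evenE)
  qed simp
  then show "asc (False # x @ [True]) = Suc (desc x)" "desc (True # x @ [False]) = Suc (asc x)" by auto
qed

text \<open>By \<open>pad_asc_desc\<close> each quadrant contains one product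
  \<open>(x + 1) * (y + 1)\<close>, where \<open>x\<close> counts the ascents or the descents of
  \<open>u\<close> or \<open>d\<close>, and \<open>y\<close> those of \<open>l\<close> or
  \<open>w\<close>. Over the four quadrants each of these counts occurs exactly once. So a value of
  at most 5 leaves room for at most one change in each of the two pairs.\<close>

lemma quad_ge: "4 + chg u + chg d \<le> quad u d l w" "4 + chg l + chg w \<le> quad u d l w"
proof -
  have *: "x + 1 \<le> a + (x + 1) * (y + 1)" "y + 1 \<le> a + (x + 1) * (y + 1)" for x y a :: nat
    by auto
  show "4 + chg u + chg d \<le> quad u d l w" "4 + chg l + chg w \<le> quad u d l w"
    unfolding quad_def pad_asc_desc chg_def by (simp_all add: algebra_simps)
qed

section \<open>Counting pairs of words by class\<close>

definition wpairs :: "nat \<Rightarrow> (bool list \<times> bool list) set" where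
  "wpairs k = {(u, d). length u + length d = k}"

lemma finite_words: "finite {x :: bool list. length x = k}"
  using finite_lists_length_eq[of "UNIV :: bool set" k] by simp

lemma wpairs_UN: "wpairs k = (\<Union>r\<le>k. {u. length u = r} \<times> {d. length d = k - r})"
  by (auto simp: wpairs_def)

lemma finite_wpairs [simp]: "finite (wpairs k)"
  unfolding wpairs_UN by (intro finite_UN_I finite_cartesian_product finite_words) auto

text \<open>The lower index of the binomial coefficient that counts the pairs of a class: the
  changes inside the words, plus one for the cut between them when both are nonempty.\<close>

fun wtype :: "(bool \<times> nat) option \<times> (bool \<times> nat) option \<Rightarrow> nat" where
  "wtype (None, Some (h, k)) = k"
| "wtype (Some (h, k), None) = k"
| "wtype (Some (h, k), Some (h', k')) = k + k' + 1"
| "wtype _ = 0"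

text \<open>The classes that \<open>quad_ge\<close> permits for values up to 5: at most one change
  in total, and not both words empty.\<close>

definition pair_classes :: "((bool \<times> nat) option \<times> (bool \<times> nat) option) list" where
  "pair_classes =
     (let C0 = [Some (True, 0), Some (False, 0)]; C1 = [Some (True, 1), Some (False, 1)] in
      List.product [None] (C0 @ C1) @ List.product (C0 @ C1) [None] @
      List.product C0 (C0 @ C1) @ List.product C1 C0)"

lemma card_len_cls:
  "card {x. length x = Suc k \<and> wcls x = Some (h, c)} = k choose c"
  by (subst card_words[symmetric, where h = h]) (auto intro!: arg_cong[of _ _ card] simp: wcls_def split: if_splits)

lemma card_len_cls0: "card {x. length x = k \<and> wcls x = Some (h, c)} = (if k = 0 then 0 else (k - 1) choose c)"
proof (cases k)
  case 0
  then have "{x. length x = k \<and> wcls x = Some (h, c)} = {}" by (auto simp: wcls_def)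
  with 0 show ?thesis by simp
qed (simp add: card_len_cls)

lemma hockey: "(\<Sum>r<k. r choose c) = k choose Suc c"
  by (induction k) auto

lemma card_wpairs_cls:
  "card {x \<in> wpairs k. map_prod wcls wcls x = (x1, x2)} =
     (\<Sum>r\<le>k. card {x. length x = r \<and> wcls x = x1} * card {x. length x = k - r \<and> wcls x = x2})"
proof -
  have eq: "{x \<in> wpairs k. map_prod wcls wcls x = (x1, x2)} =
    (\<Union>r\<in>{..k}. {x. length x = r \<and> wcls x = x1} \<times> {x. length x = k - r \<and> wcls x = x2})"
    by (auto simp: wpairs_def)
  show ?thesis unfolding eq
    by (subst card_UN_disjoint)
      (auto intro!: finite_subset[OF _ finite_words] finite_cartesian_product simp: card_cartesian_product)
qed

lemma card_len_None: "card {x. length x = k \<and> wcls x = None} = of_bool (k = 0)"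
proof -
  have "{x. length x = k \<and> wcls x = None} = (if k = 0 then {[]} else {})"
    by (auto simp: wcls_def)
  then show ?thesis by simp
qed

text \<open>One of the two words is constant, so summing over the cut is the hockey-stick identity,
  shifted because both words must be nonempty.\<close>

lemma conv0: "(\<Sum>r\<le>k. (if r = 0 then 0 else (r - 1) choose c) * (if k - r = 0 then 0 else (k - r - 1) choose 0)) = (k - 1) choose Suc c"
  for k c :: nat
proof (cases k)
  case (Suc j)
  have "(\<Sum>r\<le>k. (if r = 0 then 0 else (r - 1) choose c) * (if k - r = 0 then 0 else (k - r - 1) choose 0))
     = (\<Sum>r<j. r choose c)"
    unfolding Suc by (subst sum.atMost_Suc_shift) (auto simp: lessThan_Suc_atMost[symmetric] Suc intro!: sum.cong)
  then show ?thesis by (simp add: hockey Suc)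
qed simp

text \<open>Only the total length is prescribed, since the cut is the row or column of the
  alternating square. Joining two nonempty words gives \<open>k - 1\<close> inner gaps; changes and
  cut together are a choice of \<open>wtype x\<close> of them, in a fixed order. With an empty word
  there is no cut to choose. No class has changes in both words, so \<open>conv0\<close> covers the
  remaining cases.\<close>

lemma card_wpairs_class:
  assumes "0 < k" "x \<in> set pair_classes"
  shows "card {y \<in> wpairs k. map_prod wcls wcls y = x} = (k - 1) choose wtype x"
proof -
  have rev: "(\<Sum>r\<le>k. f r * g (k - r)) = (\<Sum>r\<le>k. g r * f (k - r))" for f g :: "nat \<Rightarrow> nat"
    by (rule sum.reindex_bij_witness[of _ "\<lambda>r. k - r" "\<lambda>r. k - r"]) auto
  have N: "card {y \<in> wpairs k. map_prod wcls wcls y = (None, Some (h, c))} = (k - 1) choose c"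
    "card {y \<in> wpairs k. map_prod wcls wcls y = (Some (h, c), None)} = (k - 1) choose c" for h c
  proof -
    show 1: "card {y \<in> wpairs k. map_prod wcls wcls y = (None, Some (h, c))} = (k - 1) choose c" 
      proof -
      have "(\<Sum>r\<le>k. of_bool (r = 0) * (if k - r = 0 then 0 else (k - r - 1) choose c)) =
        (\<Sum>r\<le>k. if r = 0 then (k - 1) choose c else 0)"
        using assms(1) by (intro sum.cong) auto
      then show ?thesis by (simp only: card_wpairs_cls card_len_None card_len_cls0) simp
    qed
    show "card {y \<in> wpairs k. map_prod wcls wcls y = (Some (h, c), None)} = (k - 1) choose c"
      using 1 by (simp only: card_wpairs_cls) (subst rev, simp)
  qed
  have S: "card {y \<in> wpairs k. map_prod wcls wcls y = (Some (h, c), Some (h', 0))} = (k - 1) choose Suc c"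
    "card {y \<in> wpairs k. map_prod wcls wcls y = (Some (h', 0), Some (h, c))} = (k - 1) choose Suc c" for h h' c
  proof -
    show 1: "card {y \<in> wpairs k. map_prod wcls wcls y = (Some (h, c), Some (h', 0))} = (k - 1) choose Suc c" 
      by (simp only: card_wpairs_cls card_len_cls0 conv0)
    show "card {y \<in> wpairs k. map_prod wcls wcls y = (Some (h', 0), Some (h, c))} = (k - 1) choose Suc c"
      using 1 by (simp only: card_wpairs_cls) (subst rev, simp)
  qed
  show ?thesis using assms(2) unfolding pair_classes_def Let_def
    by (auto simp only: List.product.simps set_append list.map append.simps list.set Un_iff insert_iff empty_iff
      N S wtype.simps add_0 add_0_right numeral_eq_Suc One_nat_def plus_nat.simps)
qed

lemma distinct_pair_classes: "distinct pair_classes"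
  by (simp add: pair_classes_def Let_def)

lemma class_mem:
  assumes "chg u + chg d \<le> 1" "u \<noteq> [] \<or> d \<noteq> []"
  shows "(wcls u, wcls d) \<in> set pair_classes"
proof -
  have "chg u = 0 \<and> chg d = 0 \<or> chg u = 0 \<and> chg d = 1 \<or> chg u = 1 \<and> chg d = 0"
    using assms(1) by arith
  then show ?thesis using assms(2)
    by (cases "hd u"; cases "hd d") (auto simp: wcls_def pair_classes_def Let_def)
qed

definition quad_tuples :: "nat \<Rightarrow> nat \<Rightarrow> nat \<Rightarrow> ((bool list \<times> bool list) \<times> (bool list \<times> bool list)) set" where
  "quad_tuples P Q k = {((u, d), (l, w)). (u, d) \<in> wpairs P \<and> (l, w) \<in> wpairs Q \<and> quad u d l w = k}"

text \<open>\<open>quad\<close> depends only on the classes, and the two pairs are independent once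
  these are fixed, so the set is a union of products of class fibres. The bound on \<open>k\<close>
  confines the classes to \<open>pair_classes\<close>.\<close>

lemma card_quad_tuples:
  assumes "0 < P" "0 < Q" "k \<le> 5"
  shows "card (quad_tuples P Q k) =
    (\<Sum>(x, y)\<leftarrow>filter (\<lambda>z. cquad z = k) (List.product pair_classes pair_classes).
       ((P - 1) choose wtype x) * ((Q - 1) choose wtype y))"
proof -
  let ?L = "filter (\<lambda>z. cquad z = k) (List.product pair_classes pair_classes)"
  let ?g = "map_prod (map_prod wcls wcls) (map_prod wcls wcls)"
  let ?S = "quad_tuples P Q k"
  have fin: "finite ?S"
    by (rule finite_subset[of _ "wpairs P \<times> wpairs Q"]) (auto simp: quad_tuples_def)
  have "?g ` ?S \<subseteq> set ?L"
  proof -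
    have "cquad ((wcls u, wcls d), (wcls l, wcls w)) = k \<and> (wcls u, wcls d) \<in> set pair_classes \<and>
      (wcls l, wcls w) \<in> set pair_classes" if "((u, d), (l, w)) \<in> ?S" for u d l w
    proof -
      have q: "quad u d l w = k" "length u + length d = P" "length l + length w = Q"
        using that by (auto simp: quad_tuples_def wpairs_def)
      have "chg u + chg d \<le> 1" "chg l + chg w \<le> 1"
        using quad_ge(1)[of u d l w] quad_ge(2)[where u = u and d = d and l = l and w = w] q assms by auto
      then show ?thesis using q assms by (auto simp: quad_wcls intro!: class_mem)
    qed
    then show ?thesis by (auto simp: image_subset_iff)
  qed
  then have "card ?S = (\<Sum>z\<in>set ?L. card {s \<in> ?S. ?g s = z})"
    using sum.group[OF fin _ , of "set ?L" ?g "\<lambda>_. 1::nat"] by simp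
  also have "\<dots> = (\<Sum>(x, y)\<in>set ?L. ((P - 1) choose wtype x) * ((Q - 1) choose wtype y))"
  proof (rule sum.cong[OF refl])
    fix z assume z: "z \<in> set ?L"
    obtain x y where xy: "z = (x, y)" by (cases z)
    with z have m: "x \<in> set pair_classes" "y \<in> set pair_classes" "cquad (x, y) = k" by auto
    have "{s \<in> ?S. ?g s = z} = {s \<in> wpairs P. map_prod wcls wcls s = x} \<times> {s \<in> wpairs Q. map_prod wcls wcls s = y}"
      using m(3) by (auto simp: quad_tuples_def xy quad_wcls)
    then show "card {s \<in> ?S. ?g s = z} = (case z of (x, y) \<Rightarrow> ((P - 1) choose wtype x) * ((Q - 1) choose wtype y))"
      using card_wpairs_class[OF assms(1) m(1)] card_wpairs_class[OF assms(2) m(2)]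
      by (simp add: card_cartesian_product xy)
  qed
  also have "\<dots> = (\<Sum>(x, y)\<leftarrow>?L. ((P - 1) choose wtype x) * ((Q - 1) choose wtype y))"
    by (subst sum_list_distinct_conv_sum_set) (auto simp: distinct_product distinct_pair_classes)
  finally show ?thesis .
qed

text \<open>Reduces the sum over class pairs to nine coefficients, since there the summand depends
  only on the two values of \<open>wtype\<close>.\<close>

lemma sum_list_count:
  "(\<Sum>z\<leftarrow>xs. f z) = (\<Sum>y\<leftarrow>ys. length (filter (\<lambda>z. t z = y) xs) * g y)"
  if "distinct ys" "\<forall>z\<in>set xs. t z \<in> set ys \<and> f z = g (t z)" for f :: "'a \<Rightarrow> nat" and g :: "'b \<Rightarrow> nat"
  using that(2)
proof (induction xs)
  case (Cons x xs)
  have "(\<Sum>y\<leftarrow>ys. length (filter (\<lambda>z. t z = y) (x # xs)) * g y) =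
    (\<Sum>y\<leftarrow>ys. length (filter (\<lambda>z. t z = y) xs) * g y + (if y = t x then g y else 0))"
    by (intro arg_cong[of _ _ sum_list] map_cong) auto
  also have "\<dots> = (\<Sum>y\<leftarrow>ys. length (filter (\<lambda>z. t z = y) xs) * g y) + (\<Sum>y\<leftarrow>ys. if y = t x then g y else 0)"
    by (simp add: sum_list_addf)
  also have "(\<Sum>y\<leftarrow>ys. if y = t x then g y else 0) = g (t x)"
    using Cons.prems that(1) by (simp add: sum_list_distinct_conv_sum_set)
  finally show ?case using Cons by simp
qed (simp)

definition class_types :: "nat \<Rightarrow> nat \<times> nat \<Rightarrow> nat" where
  "class_types k t = length (filter (\<lambda>z. map_prod wtype wtype z = t)
     (filter (\<lambda>z. cquad z = k) (List.product pair_classes pair_classes)))"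

lemma card_quad_tuples_types:
  assumes "0 < P" "0 < Q" "k \<le> 5"
  shows "card (quad_tuples P Q k) =
    (\<Sum>(i, j)\<leftarrow>List.product [0,1,2] [0,1,2]. class_types k (i, j) * (((P - 1) choose i) * ((Q - 1) choose j)))"
proof -
  have t: "wtype x \<in> set [0,1,2]" if "x \<in> set pair_classes" for x
    using that by (auto simp: pair_classes_def Let_def)
  let ?L = "filter (\<lambda>z. cquad z = k) (List.product pair_classes pair_classes)"
  let ?g = "\<lambda>x. ((P - 1) choose fst x) * ((Q - 1) choose snd x)"
  have 1: "distinct (List.product [0, 1, 2 :: nat] [0, 1, 2 :: nat])"
    by (intro distinct_product) simp_all
  have 2: "\<forall>z\<in>set ?L. map_prod wtype wtype z \<in> set (List.product [0,1,2] [0,1,2]) \<and>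
      (case z of (x, y) \<Rightarrow> ((P - 1) choose wtype x) * ((Q - 1) choose wtype y)) = ?g (map_prod wtype wtype z)"
  proof
    fix z assume "z \<in> set ?L"
    then have "fst z \<in> set pair_classes" "snd z \<in> set pair_classes" by auto
    from this[THEN t] show "map_prod wtype wtype z \<in> set (List.product [0,1,2] [0,1,2]) \<and>
      (case z of (x, y) \<Rightarrow> ((P - 1) choose wtype x) * ((Q - 1) choose wtype y)) = ?g (map_prod wtype wtype z)"
      unfolding set_product by (cases z) (simp only: map_prod_simp mem_Times_iff fst_conv snd_conv prod.case simp_thms)
  qed
  show ?thesis
    unfolding card_quad_tuples[OF assms] sum_list_count[OF 1 2] class_types_def by (simp only: case_prod_unfold prod.collapse)
qed

text \<open>Evaluated over all 400 pairs of classes. In the order (0,0), (0,1), ..., (2,2) the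
  entries are the coefficients of \<open>((P - 1) choose i) * ((Q - 1) choose j)\<close>.\<close>

lemma class_types_5: "map (class_types 5) (List.product [0,1,2] [0,1,2]) = [4,16,8,16,20,0,8,0,0]"
  unfolding class_types_def by code_simp

lemma class_types_4: "map (class_types 4) (List.product [0,1,2] [0,1,2]) = [12,8,0,8,2,0,0,0,0]"
  unfolding class_types_def by code_simp

lemma card_quad_5:
  "card (quad_tuples (Suc A) (Suc B) 5) =
     20 * A * B + 16 * A + 16 * B + 4 + 8 * (A choose 2) + 8 * (B choose 2)"
  using class_types_5 card_quad_tuples_types[of "Suc A" "Suc B" 5]
  by (simp only: List.product.simps list.map append.simps list.inject prod.case) simp

lemma card_quad_4: "card (quad_tuples (Suc A) (Suc B) 4) = 2 * A * B + 8 * A + 8 * B + 12"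
  using class_types_4 card_quad_tuples_types[of "Suc A" "Suc B" 4]
  by (simp only: List.product.simps list.map append.simps list.inject prod.case) simp

section \<open>Sign patterns and the Euler inequality\<close>

text \<open>With vertices \<open>(i, j)\<close>, \<open>i \<le> p\<close>, \<open>j \<le> q\<close>, the sign \<open>a i j\<close> belongs to the edge from \<open>(i, j)\<close> to
  \<open>(i, j + 1)\<close> and \<open>b i j\<close> to the edge from \<open>(i, j)\<close> to \<open>(i + 1, j)\<close>.\<close>

definition wf_conf :: "nat \<Rightarrow> nat \<Rightarrow> (nat \<Rightarrow> nat \<Rightarrow> bool) \<Rightarrow> (nat \<Rightarrow> nat \<Rightarrow> bool) \<Rightarrow> bool" where
  "wf_conf p q a b \<longleftrightarrow> (\<forall>i<p. \<forall>j<q. b i j = b i (Suc j) \<and> a i j = a (Suc i) j \<or>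
     b i j = a i j \<and> b i (Suc j) = (\<not> b i j) \<and> a (Suc i) j = (\<not> a i j))"

definition is_max :: "nat \<Rightarrow> (nat \<Rightarrow> bool) \<Rightarrow> nat \<Rightarrow> bool" where
  "is_max p f i \<longleftrightarrow> (i = 0 \<or> f (i - 1)) \<and> (i = p \<or> \<not> f i)"

definition is_min :: "nat \<Rightarrow> (nat \<Rightarrow> bool) \<Rightarrow> nat \<Rightarrow> bool" where
  "is_min p f i \<longleftrightarrow> (i = 0 \<or> \<not> f (i - 1)) \<and> (i = p \<or> f i)"

definition extremal where
  "extremal p q a b i j \<longleftrightarrow> is_max p (\<lambda>k. b k j) i \<and> is_max q (a i) j \<or>
     is_min p (\<lambda>k. b k j) i \<and> is_min q (a i) j"

definition num_ext :: "nat \<Rightarrow> nat \<Rightarrow> (nat \<Rightarrow> nat \<Rightarrow> bool) \<Rightarrow> (nat \<Rightarrow> nat \<Rightarrow> bool) \<Rightarrow> nat" where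
  "num_ext p q a b = card {(i, j). i \<le> p \<and> j \<le> q \<and> extremal p q a b i j}"

text \<open>Under \<open>wf_conf\<close> one pair of unequal opposite edges already makes a square
  alternating, so the signs \<open>b\<close> alone locate it.\<close>

definition alt_faces :: "nat \<Rightarrow> nat \<Rightarrow> (nat \<Rightarrow> nat \<Rightarrow> bool) \<Rightarrow> (nat \<times> nat) set" where
  "alt_faces p q b = {(i, j). i < p \<and> j < q \<and> b i j \<noteq> b i (Suc j)}"

lemma num_ext_sum: "num_ext p q a b = (\<Sum>i\<le>p. \<Sum>j\<le>q. of_bool (extremal p q a b i j))"
proof -
  have "{(i, j). i \<le> p \<and> j \<le> q \<and> extremal p q a b i j} = (SIGMA i:{..p}. {j\<in>{..q}. extremal p q a b i j})"
    by auto
  then show ?thesis by (simp add: num_ext_def Int_def)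
qed

lemma finite_alt_faces [simp]: "finite (alt_faces p q b)"
  by (rule finite_subset[of _ "{..p} \<times> {..q}"]) (auto simp: alt_faces_def)

lemma card_alt_faces: "card (alt_faces p q b) = (\<Sum>i<p. \<Sum>j<q. of_bool (b i j \<noteq> b i (Suc j)))"
proof -
  have "alt_faces p q b = (SIGMA i:{..<p}. {j\<in>{..<q}. b i j \<noteq> b i (Suc j)})"
    by (auto simp: alt_faces_def)
  then show ?thesis by (simp add: Int_def)
qed

text \<open>The boundary is read clockwise from the lower left corner; edges traversed against their
  orientation are negated.\<close>

definition boundary_word :: "nat \<Rightarrow> nat \<Rightarrow> (nat \<Rightarrow> nat \<Rightarrow> bool) \<Rightarrow> (nat \<Rightarrow> nat \<Rightarrow> bool) \<Rightarrow> bool list" where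
  "boundary_word p q a b = rev (map Not (map (\<lambda>i. b i 0) [0..<p])) @ map (a 0) [0..<q] @
     map (\<lambda>i. b i q) [0..<p] @ rev (map Not (map (a p) [0..<q]))"

lemma sum_split_ends:
  fixes g :: "nat \<Rightarrow> nat"
  assumes "0 < p"
  shows "(\<Sum>i<p. g i) = g 0 + (\<Sum>i\<in>{1..<p}. g i)"
    "(\<Sum>i<p. g (Suc i)) = (\<Sum>i\<in>{1..<p}. g i) + g p"
    "(\<Sum>i\<le>p. g i) = g 0 + (\<Sum>i\<in>{1..<p}. g i) + g p"
proof -
  show 1: "(\<Sum>i<p. g i) = g 0 + (\<Sum>i\<in>{1..<p}. g i)"
    using assms by (simp add: lessThan_atLeast0 sum.atLeast_Suc_lessThan)
  then show 3: "(\<Sum>i\<le>p. g i) = g 0 + (\<Sum>i\<in>{1..<p}. g i) + g p"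
    by (simp add: lessThan_Suc_atMost[symmetric])
  show "(\<Sum>i<p. g (Suc i)) = (\<Sum>i\<in>{1..<p}. g i) + g p"
    using 3 sum.atMost_shift[of g p] by simp
qed

lemma chg_boundary_word:
  assumes "0 < p" "0 < q"
  shows "chg (boundary_word p q a b) =
    (\<Sum>i\<in>{1..<p}. of_bool (b (i - 1) 0 \<noteq> b i 0)) + of_bool (a 0 0 = b 0 0) +
    (\<Sum>j\<in>{1..<q}. of_bool (a 0 (j - 1) \<noteq> a 0 j)) + of_bool (a 0 (q - 1) \<noteq> b 0 q) +
    (\<Sum>i\<in>{1..<p}. of_bool (b (i - 1) q \<noteq> b i q)) + of_bool (b (p - 1) q = a p (q - 1)) +
    (\<Sum>j\<in>{1..<q}. of_bool (a p (j - 1) \<noteq> a p j))"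
proof -
  have ne: "[0..<p] \<noteq> []" "[0..<q] \<noteq> []" using assms by auto
  have hl: "hd [0..<p] = 0" "hd [0..<q] = 0" "last [0..<p] = p - 1" "last [0..<q] = q - 1"
    using assms by auto
  have "of_bool ((\<not> b 0 0) \<noteq> a 0 0) = (of_bool (a 0 0 = b 0 0) :: nat)"
    "of_bool (b (p - 1) q \<noteq> (\<not> a p (q - 1))) = (of_bool (b (p - 1) q = a p (q - 1)) :: nat)"
    by auto
  then show ?thesis
    unfolding boundary_word_def using ne
    by (simp add: chg_append chg_rev chg_map_Not chg_map_upt hd_append last_append last_rev hd_rev last_map hd_map hl
        del: map_map sum_of_bool_eq)
qed

text \<open>Double counting of the corners of squares at which one edge leads up and the other down.
  An alternating square has none of them, any other square two. Around an inner vertex the signs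
  change an even number of times, and not at all only at an extremum. At a boundary vertex without a
  direction change there is one such corner; a direction change costs a second one or makes the
  vertex an extremum.\<close>

lemma euler_inequality:
  assumes wf: "wf_conf p q a b" and pq: "0 < p" "0 < q"
  shows "2 * card (alt_faces p q b) + 2 + chg (boundary_word p q a b) \<le> 2 * num_ext p q a b"
proof -
  \<comment> \<open>The names give the position of the vertex \<open>(i, j)\<close> within the
    square, such as top left. The value is 1 if the two edges of the square lead, seen from the
    vertex, one up and one down. An edge that ends at the vertex enters negated, hence the
    alternation of equality and inequality.\<close>
  define tl tr bl br where
    "tl i j = (of_bool (a i j \<noteq> b i j) :: nat)"
    and "tr i j = (of_bool (a i (j - 1) = b i j) :: nat)"
    and "bl i j = (of_bool (b (i - 1) j = a i j) :: nat)"
    and "br i j = (of_bool (a i (j - 1) \<noteq> b (i - 1) j) :: nat)" for i j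
  define ex where "ex i j = (of_bool (extremal p q a b i j) :: nat)" for i j
  note defs = tl_def tr_def bl_def br_def ex_def extremal_def is_max_def is_min_def
  have face: "tl i j + tr i (Suc j) + bl (Suc i) j + br (Suc i) (Suc j) + 2 * of_bool (b i j \<noteq> b i (Suc j)) = 2"
    if "i < p" "j < q" for i j
    using wf that unfolding wf_conf_def by (fastforce simp: tl_def tr_def bl_def br_def)
  have "(\<Sum>i<p. \<Sum>j<q. tl i j + tr i (Suc j) + bl (Suc i) j + br (Suc i) (Suc j) + 2 * of_bool (b i j \<noteq> b i (Suc j)))
      = (\<Sum>i<p. \<Sum>j<q. 2)"
    by (intro sum.cong refl face) auto
  then have F: "(\<Sum>i<p. \<Sum>j<q. tl i j) + (\<Sum>i<p. \<Sum>j<q. tr i (Suc j)) + (\<Sum>i<p. \<Sum>j<q. bl (Suc i) j)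
     + (\<Sum>i<p. \<Sum>j<q. br (Suc i) (Suc j)) + 2 * card (alt_faces p q b) = 2 * (p * q)"
    unfolding card_alt_faces by (simp add: sum.distrib sum_distrib_left del: sum_of_bool_eq)
  define I J where "I = {1..<p}" and "J = {1..<q}"
  have IJ: "i \<in> I \<longleftrightarrow> 0 < i \<and> i < p" "j \<in> J \<longleftrightarrow> 0 < j \<and> j < q" for i j
    by (auto simp: I_def J_def)
  note sp = sum_split_ends[OF pq(1), folded I_def] sum_split_ends[OF pq(2), folded J_def]
  have E: "num_ext p q a b = ex 0 0 + ex 0 q + ex p 0 + ex p q + (\<Sum>j\<in>J. ex 0 j) + (\<Sum>j\<in>J. ex p j)
     + (\<Sum>i\<in>I. ex i 0) + (\<Sum>i\<in>I. ex i q) + (\<Sum>i\<in>I. \<Sum>j\<in>J. ex i j)"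
    unfolding num_ext_sum ex_def[symmetric] sp by (simp add: sum.distrib)
  have C: "(\<Sum>i<p. \<Sum>j<q. tl i j) + (\<Sum>i<p. \<Sum>j<q. tr i (Suc j)) + (\<Sum>i<p. \<Sum>j<q. bl (Suc i) j)
     + (\<Sum>i<p. \<Sum>j<q. br (Suc i) (Suc j)) = tl 0 0 + tr 0 q + bl p 0 + br p q
     + (\<Sum>j\<in>J. tl 0 j + tr 0 j) + (\<Sum>j\<in>J. bl p j + br p j) + (\<Sum>i\<in>I. tl i 0 + bl i 0) + (\<Sum>i\<in>I. tr i q + br i q)
     + (\<Sum>i\<in>I. \<Sum>j\<in>J. tl i j + tr i j + bl i j + br i j)"
  proof -
    have "(\<Sum>i<p. \<Sum>j<q. tl i j) = tl 0 0 + (\<Sum>j\<in>J. tl 0 j) + ((\<Sum>i\<in>I. tl i 0) + (\<Sum>i\<in>I. \<Sum>j\<in>J. tl i j))"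
      unfolding sp(1,4) by (simp add: sum.distrib)
    moreover have "(\<Sum>i<p. \<Sum>j<q. tr i (Suc j)) =
        (\<Sum>j\<in>J. tr 0 j) + tr 0 q + ((\<Sum>i\<in>I. \<Sum>j\<in>J. tr i j) + (\<Sum>i\<in>I. tr i q))"
      unfolding sp(5)[of "tr i" for i] sp(1) by (simp add: sum.distrib)
    moreover have "(\<Sum>i<p. \<Sum>j<q. bl (Suc i) j) =
        (\<Sum>i\<in>I. bl i 0) + (\<Sum>i\<in>I. \<Sum>j\<in>J. bl i j) + (bl p 0 + (\<Sum>j\<in>J. bl p j))"
      unfolding sp(2)[of "\<lambda>i. \<Sum>j<q. bl i j"] unfolding sp(4) by (simp add: sum.distrib)
    moreover have "(\<Sum>i<p. \<Sum>j<q. br (Suc i) (Suc j)) =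
        (\<Sum>i\<in>I. \<Sum>j\<in>J. br i j) + (\<Sum>i\<in>I. br i q) + ((\<Sum>j\<in>J. br p j) + br p q)"
      unfolding sp(2)[of "\<lambda>i. \<Sum>j<q. br i (Suc j)"] unfolding sp(5)[of "br i" for i] by (simp add: sum.distrib)
    ultimately show ?thesis by (simp add: sum.distrib)
  qed
  have int: "(\<Sum>i\<in>I. \<Sum>j\<in>J. 2) \<le> (\<Sum>i\<in>I. \<Sum>j\<in>J. (tl i j + tr i j + bl i j + br i j) + 2 * ex i j)"
    by (intro sum_mono) (auto simp: IJ defs)
  have top: "(\<Sum>j\<in>J. 1 + of_bool (a 0 (j - 1) \<noteq> a 0 j)) \<le> (\<Sum>j\<in>J. (tl 0 j + tr 0 j) + 2 * ex 0 j)"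
    using pq by (intro sum_mono) (auto simp: IJ defs)
  have bot: "(\<Sum>j\<in>J. 1 + of_bool (a p (j - 1) \<noteq> a p j)) \<le> (\<Sum>j\<in>J. (bl p j + br p j) + 2 * ex p j)"
    using pq by (intro sum_mono) (auto simp: IJ defs)
  have left: "(\<Sum>i\<in>I. 1 + of_bool (b (i - 1) 0 \<noteq> b i 0)) \<le> (\<Sum>i\<in>I. (tl i 0 + bl i 0) + 2 * ex i 0)"
    using pq by (intro sum_mono) (auto simp: IJ defs)
  have right: "(\<Sum>i\<in>I. 1 + of_bool (b (i - 1) q \<noteq> b i q)) \<le> (\<Sum>i\<in>I. (tr i q + br i q) + 2 * ex i q)"
    using pq by (intro sum_mono) (auto simp: IJ defs)
  \<comment> \<open>The boundary word starts and ends at the corner \<open>(p, 0)\<close>, so no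
    direction change is counted there and its bound lacks the second term.\<close>
  have corners: "1 + of_bool (a 0 0 = b 0 0) \<le> tl 0 0 + 2 * ex 0 0"
    "1 + of_bool (a 0 (q - 1) \<noteq> b 0 q) \<le> tr 0 q + 2 * ex 0 q"
    "1 + of_bool (b (p - 1) q = a p (q - 1)) \<le> br p q + 2 * ex p q"
    "1 \<le> bl p 0 + 2 * ex p 0"
    using pq by (auto simp: defs)
  have cards: "card I = p - 1" "card J = q - 1" by (auto simp: I_def J_def)
  obtain p' q' where "p = Suc p'" "q = Suc q'" using pq by (metis not0_implies_Suc less_not_refl)
  \<comment> \<open>The right-hand side adds up the lower bounds of all vertices: 2 for an inner
    one, 1 for a boundary one. The surplus 2 over \<open>2 * (p * q)\<close> is the constant of the
    inequality.\<close>
  then have pq': "2 * (p * q) + 2 = 2 * ((p - 1) * (q - 1)) + 2 * (p - 1) + 2 * (q - 1) + 4" by simp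
  define ct cb cl cr ci where sides: "ct = (\<Sum>j\<in>J. tl 0 j + tr 0 j)" "cb = (\<Sum>j\<in>J. bl p j + br p j)"
    "cl = (\<Sum>i\<in>I. tl i 0 + bl i 0)" "cr = (\<Sum>i\<in>I. tr i q + br i q)"
    "ci = (\<Sum>i\<in>I. \<Sum>j\<in>J. tl i j + tr i j + bl i j + br i j)"
  define et eb el er ei where exts: "et = (\<Sum>j\<in>J. ex 0 j)" "eb = (\<Sum>j\<in>J. ex p j)"
    "el = (\<Sum>i\<in>I. ex i 0)" "er = (\<Sum>i\<in>I. ex i q)" "ei = (\<Sum>i\<in>I. \<Sum>j\<in>J. ex i j)"
  define st sb sl sr :: nat where turns: "st = (\<Sum>j\<in>J. of_bool (a 0 (j - 1) \<noteq> a 0 j))"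
    "sb = (\<Sum>j\<in>J. of_bool (a p (j - 1) \<noteq> a p j))"
    "sl = (\<Sum>i\<in>I. of_bool (b (i - 1) 0 \<noteq> b i 0))" "sr = (\<Sum>i\<in>I. of_bool (b (i - 1) q \<noteq> b i q))"
  define k1 k2 k3 :: nat where ks: "k1 = of_bool (a 0 0 = b 0 0)" "k2 = of_bool (a 0 (q - 1) \<noteq> b 0 q)"
    "k3 = of_bool (b (p - 1) q = a p (q - 1))"
  have "(q - 1) + st \<le> ct + 2 * et" "(q - 1) + sb \<le> cb + 2 * eb"
    "(p - 1) + sl \<le> cl + 2 * el" "(p - 1) + sr \<le> cr + 2 * er"
    using top bot left right unfolding sides exts turns
    by (simp_all only: sum.distrib sum_distrib_left[symmetric] sum_constant cards of_nat_id mult_1_right)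
  moreover have "2 * ((p - 1) * (q - 1)) \<le> ci + 2 * ei"
    using int unfolding sides exts by (simp add: sum.distrib sum_distrib_left cards mult_ac)
  moreover have "chg (boundary_word p q a b) = sl + k1 + st + k2 + sr + k3 + sb"
    unfolding chg_boundary_word[OF pq] turns ks I_def J_def by (rule refl)
  ultimately show ?thesis
    using F[unfolded C, folded sides] E[folded exts] corners[folded ks] pq' by linarith
qed

section \<open>Changes forced on the boundary by alternating squares\<close>

lemma subseq_upt:
  assumes "sorted_wrt (<) xs" "\<forall>x\<in>set xs. x < k"
  shows "subseq xs [0..<k]"
proof -
  have "filter (\<lambda>x. x \<in> set xs) [0..<k] = xs"
    using assms by (intro sorted_distinct_set_unique) (auto simp: strict_sorted_iff sorted_wrt_filter)
  then show ?thesis by (metis subseq_filter_left)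
qed

text \<open>The rows \<open>L\<close>, \<open>R\<close> and columns \<open>T\<close>,
  \<open>B\<close> select a subsequence of the boundary word, so a few well-chosen letters already
  force changes.\<close>

lemma chg_boundary_ge:
  assumes "sorted_wrt (<) L" "\<forall>x\<in>set L. x < p" "sorted_wrt (<) R" "\<forall>x\<in>set R. x < p"
    "sorted_wrt (<) T" "\<forall>x\<in>set T. x < q" "sorted_wrt (<) B" "\<forall>x\<in>set B. x < q"
  shows "chg (rev (map (\<lambda>i. \<not> b i 0) L) @ map (a 0) T @ map (\<lambda>i. b i q) R @ rev (map (\<lambda>j. \<not> a p j) B))
    \<le> chg (boundary_word p q a b)"
proof -
  have *: "subseq (map f xs) (map f [0..<k])" if "sorted_wrt (<) xs" "\<forall>x\<in>set xs. x < k" for xs k and f :: "nat \<Rightarrow> bool"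
    using subseq_upt[OF that] by (rule subseq_map)
  have **: "subseq (rev xs) (rev ys)" if "subseq xs ys" for xs ys :: "bool list"
    using that by (induction rule: list_emb.induct) (auto intro: list_emb_append_mono)
  have "subseq (rev (map (\<lambda>i. \<not> b i 0) L) @ map (a 0) T @ map (\<lambda>i. b i q) R @ rev (map (\<lambda>j. \<not> a p j) B))
     (rev (map (\<lambda>i. \<not> b i 0) [0..<p]) @ map (a 0) [0..<q] @ map (\<lambda>i. b i q) [0..<p] @ rev (map (\<lambda>j. \<not> a p j) [0..<q]))"
    by (intro list_emb_append_mono * ** assms)
  then have "subseq (rev (map (\<lambda>i. \<not> b i 0) L) @ map (a 0) T @ map (\<lambda>i. b i q) R @ rev (map (\<lambda>j. \<not> a p j) B))
     (boundary_word p q a b)" by (simp add: boundary_word_def comp_def)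
  then show ?thesis using chg_subseq by blast
qed

lemma alt_facesD:
  assumes "wf_conf p q a b" "(i, j) \<in> alt_faces p q b"
  shows "i < p" "j < q" "a i j = b i j" "b i (Suc j) = (\<not> b i j)" "a (Suc i) j = (\<not> b i j)"
  using assms by (auto simp: wf_conf_def alt_faces_def)

text \<open>A square that is not alternating passes the sign on unchanged; this carries signs at a
  square out to the boundary.\<close>

lemma row_const:
  assumes "\<And>j. x \<le> j \<Longrightarrow> j < y \<Longrightarrow> (i, j) \<notin> alt_faces p q b" "i < p" "x \<le> y" "y \<le> q"
  shows "b i y = b i x"
  using assms(3,1,2,4) by (induction rule: dec_induct) (auto simp: alt_faces_def)

lemma col_const:
  assumes wf: "wf_conf p q a b"
    and "\<And>i. x \<le> i \<Longrightarrow> i < y \<Longrightarrow> (i, j) \<notin> alt_faces p q b" "j < q" "x \<le> y" "y \<le> p"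
  shows "a y j = a x j"
  using assms(4,2,3,5)
proof (induction rule: dec_induct)
  case (step i)
  then have "(i, j) \<notin> alt_faces p q b" "i < p" by auto
  then have "a (Suc i) j = a i j" using wf \<open>j < q\<close> by (auto simp: wf_conf_def alt_faces_def)
  with step show ?case by simp
qed simp

text \<open>The sign changes come from the outermost alternating squares: the edges of the left, upper, right and
  lower side in the row and column of a square alternate in clockwise order.\<close>

lemma chg_boundary_ge_3:
  assumes wf: "wf_conf p q a b" and ne: "alt_faces p q b \<noteq> {}"
  shows "3 \<le> chg (boundary_word p q a b)"
proof -
  let ?A = "alt_faces p q b"
  define r where "r = Min (fst ` ?A)"
  define r' where "r' = Max (fst ` ?A)"
  have rI: "r \<in> fst ` ?A" "r' \<in> fst ` ?A" using ne by (simp_all add: r_def r'_def)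
  have rle: "r \<le> i" "i \<le> r'" if "(i, j) \<in> ?A" for i j
    using that by (force simp: r_def r'_def intro!: Min_le Max_ge)+
  define row where "row i = {j. (i, j) \<in> ?A}" for i
  have fin: "finite (row i)" for i
    by (rule finite_subset[of _ "{..q}"]) (auto simp: row_def alt_faces_def)
  have "row r \<noteq> {}" "row r' \<noteq> {}" using rI by (auto simp: row_def)
  define c where "c = Min (row r)"
  define c1 where "c1 = Max (row r)"
  define c2 where "c2 = Max (row r')"
  have mem: "(r, c) \<in> ?A" "(r, c1) \<in> ?A" "(r', c2) \<in> ?A"
    using Min_in[OF fin \<open>row r \<noteq> {}\<close>] Max_in[OF fin \<open>row r \<noteq> {}\<close>] Max_in[OF fin \<open>row r' \<noteq> {}\<close>]
    by (auto simp: row_def c_def c1_def c2_def)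
  note D = mem[THEN alt_facesD(1)[OF wf]] mem[THEN alt_facesD(2)[OF wf]] mem[THEN alt_facesD(3)[OF wf]]
    mem[THEN alt_facesD(4)[OF wf]] mem[THEN alt_facesD(5)[OF wf]]
  have ext: "c \<le> j" "j \<le> c1" if "(r, j) \<in> ?A" for j
    using that fin by (auto simp: row_def c_def c1_def intro!: Min_le Max_ge)
  have ext2: "j \<le> c2" if "(r', j) \<in> ?A" for j
    using that fin by (auto simp: row_def c2_def intro!: Max_ge)
  have bl: "b r c = b r 0" by (rule row_const) (use D ext in force)+
  have br: "b r q = b r (Suc c1)" by (rule row_const) (use D ext in force)+
  have br2: "b r' q = b r' (Suc c2)" by (rule row_const) (use D ext2 in force)+
  have at: "a r c = a 0 c" by (rule col_const[OF wf]) (use D rle in force)+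
  have at1: "a r c1 = a 0 c1" by (rule col_const[OF wf]) (use D rle in force)+
  have ab: "a p c2 = a (Suc r') c2" by (rule col_const[OF wf]) (use D rle in force)+
  show ?thesis
  \<comment> \<open>In all three cases four sampled letters alternate. The first two are the left
    end of row \<open>r\<close> and the top of column \<open>c\<close>. The other two are the top of
    column \<open>c1\<close> and the right end of row \<open>r\<close>, or the right end of row
    \<open>r\<close> and the bottom of column \<open>c2\<close>, or the right ends of rows
    \<open>r\<close> and \<open>r'\<close>.\<close>
  proof (cases "b r c1 = b r c")
    case False
    then have "c < c1" using ext[OF mem(1)] by (cases "c = c1") auto
    then show ?thesis using chg_boundary_ge[of "[r]" p "[r]" "[c, c1]" q "[]" b a] D bl br at at1 False
      by (cases "b r c") auto
  next
    case True
    show ?thesis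
    proof (cases "b r' c2 = b r c")
      case True
      with \<open>b r c1 = b r c\<close> show ?thesis
        using chg_boundary_ge[of "[r]" p "[r]" "[c]" q "[c2]" b a] D bl br at at1 ab
        by (cases "b r c") auto
    next
      case False
      have "r \<noteq> r'"
      proof
        assume "r = r'"
        then have "c1 = c2" by (simp add: c1_def c2_def)
        with \<open>r = r'\<close> False True show False by simp
      qed
      then have "r < r'" using rle(2)[OF mem(1)] by auto
      with False True show ?thesis
        using chg_boundary_ge[of "[r]" p "[r, r']" "[c]" q "[]" b a] D bl br at at1 br2
        by (cases "b r c") auto
    qed
  qed
qed

lemma two_alt_faces:
  assumes wf: "wf_conf p q a b" and two: "card (alt_faces p q b) = 2"
    and chg: "chg (boundary_word p q a b) \<le> 4"
  obtains r c where "Suc r < p" "Suc c < q" "alt_faces p q b = {(r, c), (Suc r, Suc c)}" "b (Suc r) (Suc c) = b r c"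
  | r c where "Suc r < p" "Suc c < q" "alt_faces p q b = {(r, Suc c), (Suc r, c)}" "b (Suc r) c = b r (Suc c)"
proof -
  let ?A = "alt_faces p q b"
  obtain f g where "f \<noteq> g" "?A = {f, g}" using two by (auto simp: card_2_iff)
  then obtain r1 c1 r2 c2 where A: "?A = {(r1, c1), (r2, c2)}" and ord: "r1 < r2 \<or> r1 = r2 \<and> c1 < c2"
  proof (cases f; cases g)
    fix r1 c1 r2 c2 assume *: "f = (r1, c1)" "g = (r2, c2)"
    then have "(r1 < r2 \<or> r1 = r2 \<and> c1 < c2) \<or> (r2 < r1 \<or> r2 = r1 \<and> c2 < c1)" using \<open>f \<noteq> g\<close> by auto
    with that[of r1 c1 r2 c2] that[of r2 c2 r1 c1] * \<open>?A = {f, g}\<close> show thesis by auto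
  qed
  have mem: "(r1, c1) \<in> ?A" "(r2, c2) \<in> ?A" using A by auto
  note D = mem[THEN alt_facesD(1)[OF wf]] mem[THEN alt_facesD(2)[OF wf]] mem[THEN alt_facesD(3)[OF wf]]
    mem[THEN alt_facesD(4)[OF wf]] mem[THEN alt_facesD(5)[OF wf]]
  note rc = row_const[where p = p and q = q and b = b, unfolded A]
  note cc = col_const[OF wf, unfolded A]
  have "r1 \<noteq> r2"
  proof
    assume r: "r1 = r2"
    then have "c1 < c2" using ord by auto
    \<comment> \<open>In a common row the squares share the sign between them and so have opposite
      types; the six sampled letters alternate. A common column is analogous.\<close>
    have "b r1 c1 = b r1 0" "b r1 c2 = b r1 (Suc c1)" "b r1 q = b r1 (Suc c2)"
      "a r1 c1 = a 0 c1" "a r1 c2 = a 0 c2" "a p c1 = a (Suc r1) c1" "a p c2 = a (Suc r1) c2"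
      by (((rule rc | rule cc); (use D r \<open>c1 < c2\<close> in force))+)
    then show False using chg chg_boundary_ge[of "[r1]" p "[r1]" "[c1, c2]" q "[c1, c2]" b a] D r \<open>c1 < c2\<close>
      by (cases "b r1 c1") auto
  qed
  with ord have "r1 < r2" by auto
  have "c1 \<noteq> c2"
  proof
    assume c: "c1 = c2"
    have "b r1 c1 = b r1 0" "b r2 c2 = b r2 0" "b r1 q = b r1 (Suc c1)" "b r2 q = b r2 (Suc c2)"
      "a r1 c1 = a 0 c1" "a r2 c1 = a (Suc r1) c1" "a p c1 = a (Suc r2) c1"
      by (((rule rc | rule cc); (use D c \<open>r1 < r2\<close> in force))+)
    then show False using chg chg_boundary_ge[of "[r1, r2]" p "[r1, r2]" "[c1]" q "[c1]" b a] D c \<open>r1 < r2\<close>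
      by (cases "b r1 c1") auto
  qed
  have sides: "b r1 0 = b r1 c1" "b r2 0 = b r2 c2" "b r1 q = (\<not> b r1 c1)" "b r2 q = (\<not> b r2 c2)"
    "a 0 c1 = b r1 c1" "a 0 c2 = b r2 c2" "a p c1 = (\<not> b r1 c1)" "a p c2 = (\<not> b r2 c2)"
  proof -
    have "b r1 c1 = b r1 0" "b r2 c2 = b r2 0" "b r1 q = b r1 (Suc c1)" "b r2 q = b r2 (Suc c2)"
      "a r1 c1 = a 0 c1" "a r2 c2 = a 0 c2" "a p c1 = a (Suc r1) c1" "a p c2 = a (Suc r2) c2"
      by (((rule rc | rule cc); (use D \<open>r1 < r2\<close> \<open>c1 \<noteq> c2\<close> in force))+)
    then show "b r1 0 = b r1 c1" "b r2 0 = b r2 c2" "b r1 q = (\<not> b r1 c1)" "b r2 q = (\<not> b r2 c2)"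
      "a 0 c1 = b r1 c1" "a 0 c2 = b r2 c2" "a p c1 = (\<not> b r1 c1)" "a p c2 = (\<not> b r2 c2)"
      using D by auto
  qed
  define x y where "x = min c1 c2" and "y = max c1 c2"
  have xy: "x < y" "y < q" "c1 = x \<and> c2 = y \<or> c1 = y \<and> c2 = x"
    using \<open>c1 \<noteq> c2\<close> D by (auto simp: x_def y_def)
  have same: "b r2 c2 = b r1 c1"
    using chg chg_boundary_ge[of "[r1, r2]" p "[r1, r2]" "[x, y]" q "[x, y]" b a] D xy sides \<open>r1 < r2\<close>
    by (cases "b r1 c1"; cases "b r2 c2") auto
  have "r2 = Suc r1"
  proof (rule ccontr)
    assume "r2 \<noteq> Suc r1"
    then have z: "r1 < Suc r1" "Suc r1 < r2" using \<open>r1 < r2\<close> by auto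
    \<comment> \<open>The row in between has equal signs at both ends, but the two sides are read in
      opposite directions. So on one side its letter differs from both neighbours and adds two
      changes to the three that are there anyway.\<close>
    have "b (Suc r1) q = b (Suc r1) 0" by (rule rc; use z D in force)
    then show False
      using chg chg_boundary_ge[of "[r1, Suc r1, r2]" p "[r1, Suc r1, r2]" "[x]" q "[x]" b a] D xy sides z same
      by (cases "b r1 c1"; cases "b (Suc r1) 0") auto
  qed
  have "y = Suc x"
  proof (rule ccontr)
    assume "y \<noteq> Suc x"
    then have z: "x < Suc x" "Suc x < y" using xy by auto
    have "a p (Suc x) = a 0 (Suc x)" by (rule cc; use z D xy in force)
    then show False
      using chg chg_boundary_ge[of "[r1]" p "[r1]" "[x, Suc x, y]" q "[x, Suc x, y]" b a] D xy sides z same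
      by (cases "b r1 c1"; cases "a 0 (Suc x)") auto
  qed
  from xy(3) show thesis
  proof
    assume "c1 = x \<and> c2 = y"
    then show thesis using that(1)[of r1 x] A D same \<open>r2 = Suc r1\<close> \<open>y = Suc x\<close> by auto
  next
    assume "c1 = y \<and> c2 = x"
    then show thesis using that(2)[of r1 x] A D same \<open>r2 = Suc r1\<close> \<open>y = Suc x\<close> by auto
  qed
qed

section \<open>Patterns with at most two alternating squares\<close>

text \<open>The padding letters replace the missing edges beyond the ends and make the condition
  there automatic.\<close>

definition max_ind :: "bool list \<Rightarrow> nat \<Rightarrow> nat" where
  "max_ind w i = of_bool ((True # w) ! i \<and> \<not> (w @ [False]) ! i)"
definition min_ind :: "bool list \<Rightarrow> nat \<Rightarrow> nat" where
  "min_ind w i = of_bool (\<not> (False # w) ! i \<and> (w @ [True]) ! i)"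

text \<open>Words are relative to \<open>s\<close>: the letter \<open>True\<close> stands for the
  sign \<open>s\<close>, so both types of alternating square are treated at once.\<close>

definition prof_conf :: "nat \<Rightarrow> nat \<Rightarrow> bool \<Rightarrow> (nat \<Rightarrow> bool list) \<Rightarrow> (nat \<Rightarrow> bool list) \<Rightarrow>
    (nat \<Rightarrow> nat \<Rightarrow> bool) \<times> (nat \<Rightarrow> nat \<Rightarrow> bool)" where
  "prof_conf p q s A B =
     (\<lambda>i j. i \<le> p \<and> j < q \<and> A i ! j = s, \<lambda>i j. i < p \<and> j \<le> q \<and> B j ! i = s)"

text \<open>Values outside the grid are normalised, so that counting pairs of functions counts
  patterns.\<close>

definition confs :: "nat \<Rightarrow> nat \<Rightarrow> ((nat \<Rightarrow> nat \<Rightarrow> bool) \<times> (nat \<Rightarrow> nat \<Rightarrow> bool)) set" where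
  "confs p q = {(a, b). wf_conf p q a b \<and> (\<forall>i j. a i j \<longrightarrow> i \<le> p \<and> j < q) \<and> (\<forall>i j. b i j \<longrightarrow> i < p \<and> j \<le> q)}"

lemma is_max_ind:
  assumes "\<And>k. k < p \<Longrightarrow> f k = (w ! k = s)" "length w = p" "i \<le> p"
  shows "of_bool (is_max p f i) = (if s then max_ind w i else min_ind w i)"
    "of_bool (is_min p f i) = (if s then min_ind w i else max_ind w i)"
  using assms by (auto simp: is_max_def is_min_def max_ind_def min_ind_def nth_Cons' nth_append)

lemma not_max_min: "0 < p \<Longrightarrow> i \<le> p \<Longrightarrow> \<not> (is_max p f i \<and> is_min p f i)"
  by (auto simp: is_max_def is_min_def)

text \<open>Negating all signs swaps maxima and minima, which is why \<open>s\<close> disappears. No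
  vertex is both, so the disjunction in \<open>extremal\<close> becomes a sum.\<close>

lemma num_ext_prof:
  assumes "\<And>i. i \<le> p \<Longrightarrow> length (A i) = q" "\<And>j. j \<le> q \<Longrightarrow> length (B j) = p" "0 < p"
    and ab: "prof_conf p q s A B = (a, b)"
  shows "num_ext p q a b = (\<Sum>i\<le>p. \<Sum>j\<le>q. max_ind (B j) i * max_ind (A i) j + min_ind (B j) i * min_ind (A i) j)"
  unfolding num_ext_sum
proof (intro sum.cong refl)
  fix i j assume "i \<in> {..p}" "j \<in> {..q}"
  then have ij: "i \<le> p" "j \<le> q" by auto
  have a: "a i k = (A i ! k = s)" if "k < q" for k using that ij ab by (auto simp: prof_conf_def)
  have b: "b k j = (B j ! k = s)" if "k < p" for k using that ij ab by (auto simp: prof_conf_def)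
  note M = is_max_ind[of p "\<lambda>k. b k j" "B j" s i, OF b assms(2)[OF ij(2)] ij(1)]
    is_max_ind[of q "a i" "A i" s j, OF a assms(1)[OF ij(1)] ij(2)]
  have "of_bool (extremal p q a b i j) = of_bool (is_max p (\<lambda>k. b k j) i) * of_bool (is_max q (a i) j)
     + of_bool (is_min p (\<lambda>k. b k j) i) * (of_bool (is_min q (a i) j) :: nat)"
    using not_max_min[OF assms(3) ij(1), of "\<lambda>k. b k j"] by (auto simp: extremal_def)
  then show "of_bool (extremal p q a b i j) = max_ind (B j) i * max_ind (A i) j + min_ind (B j) i * min_ind (A i) j"
    using M by (cases s) (simp_all only: if_True if_False add.commute)
qed

text \<open>All products in the formulas for the number of extrema come from here: vertices of a
  rectangle that see the same row word and the same column word.\<close>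

lemma block_sum:
  assumes "\<And>i. i \<in> I \<Longrightarrow> A i = A'" "\<And>j. j \<in> J \<Longrightarrow> B j = B'"
  shows "(\<Sum>i\<in>I. \<Sum>j\<in>J. max_ind (B j) i * max_ind (A i) j + min_ind (B j) i * min_ind (A i) j)
    = sum (max_ind B') I * sum (max_ind A') J + sum (min_ind B') I * sum (min_ind A') J"
proof -
  have "(\<Sum>i\<in>I. \<Sum>j\<in>J. max_ind (B j) i * max_ind (A i) j + min_ind (B j) i * min_ind (A i) j)
     = (\<Sum>i\<in>I. \<Sum>j\<in>J. max_ind B' i * max_ind A' j + min_ind B' i * min_ind A' j)"
    using assms by (intro sum.cong) auto
  then show ?thesis by (simp add: sum.distrib sum_product)
qed

lemma sum_ind_all:
  "sum (max_ind w) {..length w} = desc (True # w @ [False])"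
  "sum (min_ind w) {..length w} = asc (False # w @ [True])"
  unfolding desc_sum asc_sum max_ind_def min_ind_def
  by (intro sum.cong; auto simp: nth_Cons' nth_append)+

text \<open>The edge with letter \<open>x\<close> starts at vertex \<open>length u\<close>, so
  \<open>x\<close> is the closing letter for the vertices up to there.\<close>

lemma sum_ind_left:
  "sum (max_ind (u @ x # d)) {..length u} = desc (True # u @ [x])"
  "sum (min_ind (u @ x # d)) {..length u} = asc (False # u @ [x])"
  unfolding desc_sum asc_sum max_ind_def min_ind_def
  by (intro sum.cong; auto simp: nth_Cons' nth_append)+

lemma sum_ind_right:
  assumes "r = length u" "p = Suc (length u + length d)"
  shows "sum (max_ind (u @ x # d)) {r<..p} = desc (x # d @ [False])"
  "sum (min_ind (u @ x # d)) {r<..p} = asc (x # d @ [True])"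
proof -
  have img: "{r<..p} = (\<lambda>k. Suc (length u + k)) ` {..<Suc (length d)}"
  proof (intro equalityI subsetI)
    fix i assume "i \<in> {r<..p}"
    then have "i = Suc (length u + (i - Suc (length u)))" "i - Suc (length u) < Suc (length d)"
      using assms by auto
    then show "i \<in> (\<lambda>k. Suc (length u + k)) ` {..<Suc (length d)}" by blast
  qed (auto simp: assms)
  have inj: "inj_on (\<lambda>k. Suc (length u + k)) X" for X by (simp add: inj_on_def)
  show "sum (max_ind (u @ x # d)) {r<..p} = desc (x # d @ [False])"
    "sum (min_ind (u @ x # d)) {r<..p} = asc (x # d @ [True])"
    unfolding desc_sum asc_sum max_ind_def min_ind_def img sum.reindex[OF inj] comp_def
    by (intro sum.cong; auto simp: nth_Cons' nth_append)+
qed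

lemma ind_middle:
  "max_ind (u @ x # y # d) (Suc (length u)) = of_bool (x \<and> \<not> y)"
  "min_ind (u @ x # y # d) (Suc (length u)) = of_bool (\<not> x \<and> y)"
  by (auto simp: max_ind_def min_ind_def nth_Cons' nth_append)

lemma sum_split_at:
  fixes g :: "nat \<Rightarrow> nat"
  assumes "r < p"
  shows "sum g {..p} = sum g {..r} + sum g {r<..p}"
proof -
  have "{..p} = {..r} \<union> {r<..p}" using assms by auto
  moreover have "sum g ({..r} \<union> {r<..p}) = sum g {..r} + sum g {r<..p}"
    by (rule sum.union_disjoint) auto
  ultimately show ?thesis by simp
qed

lemma sum_split_at2:
  fixes g :: "nat \<Rightarrow> nat"
  assumes "Suc r < p"
  shows "sum g {..p} = sum g {..r} + sum g {Suc r} + sum g {Suc r<..p}"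
  using sum_split_at[OF assms, of g] by simp

definition conf0 where
  "conf0 p q = (\<lambda>(\<beta>, \<alpha>). prof_conf p q True (\<lambda>i. \<alpha>) (\<lambda>j. \<beta>))"

text \<open>The square lies in row \<open>length u\<close> and column \<open>length l\<close>, so
  the lengths encode its position. Passing it alters a single letter of the row words and of the
  column words.\<close>

definition conf1 where
  "conf1 p q = (\<lambda>(s, (u, d), (l, w)).
     prof_conf p q s (\<lambda>i. l @ (i \<le> length u) # w) (\<lambda>j. u @ (j \<le> length l) # d))"

text \<open>The flag \<open>t\<close> tells whether the two alternating squares lie on a diagonal or on an antidiagonal of the
  two by two block.\<close>

definition conf2 where
  "conf2 p q = (\<lambda>(s, t, (u, d), (l, w)).
     prof_conf p q s
       (\<lambda>i. l @ (i \<le> (if t then length u else Suc (length u))) # (i \<le> (if t then Suc (length u) else length u)) # w)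
       (\<lambda>j. u @ (j \<le> (if t then length l else Suc (length l))) # (j \<le> (if t then Suc (length l) else length l)) # d))"

section \<open>Extrema of the three families of patterns\<close>

lemma num_ext_conf0:
  assumes "length \<beta> = p" "length \<alpha> = q" "0 < p" "conf0 p q (\<beta>, \<alpha>) = (a, b)"
  shows "num_ext p q a b = Suc (asc \<beta>) * Suc (asc \<alpha>) + Suc (desc \<beta>) * Suc (desc \<alpha>)"
proof -
  have "num_ext p q a b = (\<Sum>i\<le>p. \<Sum>j\<le>q. max_ind \<beta> i * max_ind \<alpha> j + min_ind \<beta> i * min_ind \<alpha> j)"
    by (rule num_ext_prof[where s = True]) (use assms in \<open>auto simp: conf0_def\<close>)
  also have "\<dots> = sum (max_ind \<beta>) {..p} * sum (max_ind \<alpha>) {..q} + sum (min_ind \<beta>) {..p} * sum (min_ind \<alpha>) {..q}"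
    by (rule block_sum) auto
  finally show ?thesis unfolding assms(1,2)[symmetric] sum_ind_all pad_asc_desc .
qed

text \<open>Cutting the vertices after row \<open>length u\<close> and column
  \<open>length l\<close> leaves four blocks on which neither word varies; the letter of the square
  becomes an end letter of the padded words.\<close>

lemma num_ext_conf1:
  assumes len: "p = Suc (length u + length d)" "q = Suc (length l + length w)"
    and ab: "conf1 p q (s, (u, d), (l, w)) = (a, b)"
  shows "num_ext p q a b = quad u d l w"
proof -
  let ?r = "length u" and ?c = "length l"
  let ?A = "\<lambda>i. l @ (i \<le> ?r) # w" and ?B = "\<lambda>j. u @ (j \<le> ?c) # d"
  let ?g = "\<lambda>i j. max_ind (?B j) i * max_ind (?A i) j + min_ind (?B j) i * min_ind (?A i) j"
  have *: "num_ext p q a b = (\<Sum>i\<le>p. \<Sum>j\<le>q. ?g i j)"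
    by (rule num_ext_prof[where s = s]) (use assms in \<open>auto simp: conf1_def\<close>)
  have pq: "?r < p" "?c < q" using len by auto
  note S = sum_ind_left sum_ind_right[OF refl len(1)] sum_ind_right[OF refl len(2)]
  have blk: "(\<Sum>i\<in>I. \<Sum>j\<in>J. ?g i j) = sum (max_ind B') I * sum (max_ind A') J + sum (min_ind B') I * sum (min_ind A') J"
    if "\<And>i. i \<in> I \<Longrightarrow> ?A i = A'" "\<And>j. j \<in> J \<Longrightarrow> ?B j = B'" for I J A' B'
    by (rule block_sum) (use that in auto)
  let ?I1 = "{..?r}" and ?I2 = "{?r<..p}" and ?J1 = "{..?c}" and ?J2 = "{?c<..q}"
  note b = blk[of ?I1 "l @ True # w" ?J1 "u @ True # d"] blk[of ?I1 "l @ True # w" ?J2 "u @ False # d"]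
    blk[of ?I2 "l @ False # w" ?J1 "u @ True # d"] blk[of ?I2 "l @ False # w" ?J2 "u @ False # d"]
  have B: "(\<Sum>i\<in>?I1. \<Sum>j\<in>?J1. ?g i j) = desc (True # u @ [True]) * desc (True # l @ [True]) + asc (False # u @ [True]) * asc (False # l @ [True])"
    "(\<Sum>i\<in>?I1. \<Sum>j\<in>?J2. ?g i j) = desc (True # u @ [False]) * desc (True # w @ [False]) + asc (False # u @ [False]) * asc (True # w @ [True])"
    "(\<Sum>i\<in>?I2. \<Sum>j\<in>?J1. ?g i j) = desc (True # d @ [False]) * desc (True # l @ [False]) + asc (True # d @ [True]) * asc (False # l @ [False])"
    "(\<Sum>i\<in>?I2. \<Sum>j\<in>?J2. ?g i j) = desc (False # d @ [False]) * desc (False # w @ [False]) + asc (False # d @ [True]) * asc (False # w @ [True])"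
    by (subst b; auto simp: S simp del: asc.simps desc.simps)+
  show ?thesis
    unfolding * sum_split_at[OF pq(1)] sum_split_at[OF pq(2)]
    using B by (simp add: sum.distrib quad_def del: asc.simps desc.simps)
qed

text \<open>Besides the quadrants there are a middle row and a middle column of vertices. Their
  common vertex, where the squares touch, is always an extremum, which gives the \<open>Suc\<close>.
  The other vertices of this cross see two equal letters in one direction and are not
  extrema.\<close>

lemma num_ext_conf2:
  assumes len: "p = Suc (Suc (length u + length d))" "q = Suc (Suc (length l + length w))"
    and ab: "conf2 p q (s, t, (u, d), (l, w)) = (a, b)"
  shows "num_ext p q a b = Suc (quad u d l w)"
proof -
  let ?r = "length u" and ?c = "length l"
  let ?A = "\<lambda>i. l @ (i \<le> (if t then ?r else Suc ?r)) # (i \<le> (if t then Suc ?r else ?r)) # w"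
  let ?B = "\<lambda>j. u @ (j \<le> (if t then ?c else Suc ?c)) # (j \<le> (if t then Suc ?c else ?c)) # d"
  let ?g = "\<lambda>i j. max_ind (?B j) i * max_ind (?A i) j + min_ind (?B j) i * min_ind (?A i) j"
  have *: "num_ext p q a b = (\<Sum>i\<le>p. \<Sum>j\<le>q. ?g i j)"
    by (rule num_ext_prof[where s = s]) (use assms in \<open>auto simp: conf2_def\<close>)
  have pq: "Suc ?r < p" "Suc ?c < q" using len by auto
  have R: "sum (max_ind (u @ x # y # d)) {Suc ?r<..p} = desc (y # d @ [False])"
    "sum (min_ind (u @ x # y # d)) {Suc ?r<..p} = asc (y # d @ [True])"
    "sum (max_ind (l @ x # y # w)) {Suc ?c<..q} = desc (y # w @ [False])"
    "sum (min_ind (l @ x # y # w)) {Suc ?c<..q} = asc (y # w @ [True])" for x y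
    using sum_ind_right[of "Suc ?r" "u @ [x]" p d y] sum_ind_right[of "Suc ?c" "l @ [x]" q w y] len by auto
  note S = sum_ind_left R ind_middle
  have blk: "(\<Sum>i\<in>I. \<Sum>j\<in>J. ?g i j) = sum (max_ind B') I * sum (max_ind A') J + sum (min_ind B') I * sum (min_ind A') J"
    if "\<And>i. i \<in> I \<Longrightarrow> ?A i = A'" "\<And>j. j \<in> J \<Longrightarrow> ?B j = B'" for I J A' B'
    by (rule block_sum) (use that in auto)
  let ?I1 = "{..?r}" and ?I2 = "{Suc ?r}" and ?I3 = "{Suc ?r<..p}"
  let ?J1 = "{..?c}" and ?J2 = "{Suc ?c}" and ?J3 = "{Suc ?c<..q}"
  note b = blk[of ?I1 "l @ True # True # w" ?J1 "u @ True # True # d"]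
    blk[of ?I1 "l @ True # True # w" ?J2 "u @ (\<not> t) # t # d"]
    blk[of ?I1 "l @ True # True # w" ?J3 "u @ False # False # d"]
    blk[of ?I2 "l @ (\<not> t) # t # w" ?J1 "u @ True # True # d"]
    blk[of ?I2 "l @ (\<not> t) # t # w" ?J2 "u @ (\<not> t) # t # d"]
    blk[of ?I2 "l @ (\<not> t) # t # w" ?J3 "u @ False # False # d"]
    blk[of ?I3 "l @ False # False # w" ?J1 "u @ True # True # d"]
    blk[of ?I3 "l @ False # False # w" ?J2 "u @ (\<not> t) # t # d"]
    blk[of ?I3 "l @ False # False # w" ?J3 "u @ False # False # d"]
  have B: "(\<Sum>i\<in>?I1. \<Sum>j\<in>?J1. ?g i j) = desc (True # u @ [True]) * desc (True # l @ [True]) + asc (False # u @ [True]) * asc (False # l @ [True])"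
    "(\<Sum>i\<in>?I1. \<Sum>j\<in>?J2. ?g i j) = 0"
    "(\<Sum>i\<in>?I1. \<Sum>j\<in>?J3. ?g i j) = desc (True # u @ [False]) * desc (True # w @ [False]) + asc (False # u @ [False]) * asc (True # w @ [True])"
    "(\<Sum>i\<in>?I2. \<Sum>j\<in>?J1. ?g i j) = 0" "(\<Sum>i\<in>?I2. \<Sum>j\<in>?J2. ?g i j) = 1" "(\<Sum>i\<in>?I2. \<Sum>j\<in>?J3. ?g i j) = 0"
    "(\<Sum>i\<in>?I3. \<Sum>j\<in>?J1. ?g i j) = desc (True # d @ [False]) * desc (True # l @ [False]) + asc (True # d @ [True]) * asc (False # l @ [False])"
    "(\<Sum>i\<in>?I3. \<Sum>j\<in>?J2. ?g i j) = 0"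
    "(\<Sum>i\<in>?I3. \<Sum>j\<in>?J3. ?g i j) = desc (False # d @ [False]) * desc (False # w @ [False]) + asc (False # d @ [True]) * asc (False # w @ [True])"
    by (subst b; auto simp: S simp del: asc.simps desc.simps)+
  show ?thesis
    unfolding * sum_split_at2[OF pq(1)] sum_split_at2[OF pq(2)]
    using B by (simp add: sum.distrib quad_def del: asc.simps desc.simps)
qed

definition confs5 :: "nat \<Rightarrow> nat \<Rightarrow> nat \<Rightarrow> ((nat \<Rightarrow> nat \<Rightarrow> bool) \<times> (nat \<Rightarrow> nat \<Rightarrow> bool)) set" where
  "confs5 p q k = {(a, b) \<in> confs p q. card (alt_faces p q b) = k \<and> num_ext p q a b = 5}"

lemma prof_conf_eqI:
  assumes "(a, b) \<in> confs p q" "\<And>i j. i \<le> p \<Longrightarrow> j < q \<Longrightarrow> a i j = (A i ! j = s)"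
    "\<And>i j. i < p \<Longrightarrow> j \<le> q \<Longrightarrow> b i j = (B j ! i = s)"
  shows "(a, b) = prof_conf p q s A B"
proof -
  have "a i j = (i \<le> p \<and> j < q \<and> A i ! j = s)" "b i j = (i < p \<and> j \<le> q \<and> B j ! i = s)" for i j
    using assms(1) assms(2)[of i j] assms(3)[of i j] by (auto simp: confs_def)
  then show ?thesis unfolding prof_conf_def by (simp add: fun_eq_iff)
qed

lemma prof_conf_in_confs:
  assumes "\<And>i j. i < p \<Longrightarrow> j < q \<Longrightarrow> B j ! i = B (Suc j) ! i \<and> A i ! j = A (Suc i) ! j \<or>
     B j ! i = A i ! j \<and> B (Suc j) ! i = (\<not> B j ! i) \<and> A (Suc i) ! j = (\<not> A i ! j)"
  shows "prof_conf p q s A B \<in> confs p q"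
proof -
  let ?a = "\<lambda>i j. i \<le> p \<and> j < q \<and> A i ! j = s" and ?b = "\<lambda>i j. i < p \<and> j \<le> q \<and> B j ! i = s"
  have "?b i j = ?b i (Suc j) \<and> ?a i j = ?a (Suc i) j \<or>
      ?b i j = ?a i j \<and> ?b i (Suc j) = (\<not> ?b i j) \<and> ?a (Suc i) j = (\<not> ?a i j)"
    if "i < p" "j < q" for i j
    using assms[OF that] that by (cases s; cases "B j ! i"; cases "A i ! j") simp_all
  then show ?thesis by (simp add: confs_def prof_conf_def wf_conf_def)
qed

lemma alt_faces_prof:
  "prof_conf p q s A B = (a, b) \<Longrightarrow> alt_faces p q b = {(i, j). i < p \<and> j < q \<and> B j ! i \<noteq> B (Suc j) ! i}"
  by (auto simp: prof_conf_def alt_faces_def)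

text \<open>Row 0 and column 0 suffice, because in each family they determine the other words once
  the positions of the squares are known.\<close>

lemma prof_conf_inj:
  assumes "prof_conf p q s A B = prof_conf p q s A' B'"
    "length (A 0) = q" "length (A' 0) = q" "length (B 0) = p" "length (B' 0) = p"
  shows "A 0 = A' 0" "B 0 = B' 0"
proof -
  have "(0 \<le> p \<and> j < q \<and> A 0 ! j = s) = (0 \<le> p \<and> j < q \<and> A' 0 ! j = s)"
    "(i < p \<and> 0 \<le> q \<and> B 0 ! i = s) = (i < p \<and> 0 \<le> q \<and> B' 0 ! i = s)" for i j
    using assms(1) unfolding prof_conf_def prod.inject fun_eq_iff by blast+
  then have "A 0 ! j = A' 0 ! j" if "j < q" for j using that by auto
  then show "A 0 = A' 0" using assms by (intro nth_equalityI) auto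
  have "B 0 ! i = B' 0 ! i" if "i < p" for i
    using \<open>\<And>i j. (i < p \<and> 0 \<le> q \<and> B 0 ! i = s) = (i < p \<and> 0 \<le> q \<and> B' 0 ! i = s)\<close>[of i] that by auto
  then show "B 0 = B' 0" using assms by (intro nth_equalityI) auto
qed

lemma nth_middle_neq:
  "(u @ x # d) ! i \<noteq> (u @ y # d) ! i \<longleftrightarrow> i = length u \<and> x \<noteq> y"
  by (auto simp: nth_append nth_Cons')

lemma nth_middle2_neq:
  "(u @ x # x' # d) ! i \<noteq> (u @ y # y' # d) ! i \<longleftrightarrow> i = length u \<and> x \<noteq> y \<or> i = Suc (length u) \<and> x' \<noteq> y'"
proof -
  consider "i < length u" | "i = length u" | "i = Suc (length u)" | k where "i = Suc (Suc (length u + k))"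
    by (metis less_Suc_eq_le less_imp_Suc_add linorder_cases not_less_eq add_Suc)
  then show ?thesis by cases (simp_all add: nth_append)
qed

lemma le_neq_Suc_le: "(j \<le> c) \<noteq> (Suc j \<le> c) \<longleftrightarrow> j = (c :: nat)"
  by auto

lemma confs_wf: "(a, b) \<in> confs p q \<Longrightarrow> wf_conf p q a b"
  by (simp add: confs_def)

lemma row_no_face:
  assumes "\<And>j. (i, j) \<notin> alt_faces p q b" "i < p" "j \<le> q"
  shows "b i j = b i 0"
  by (rule row_const) (use assms in auto)

lemma col_no_face:
  assumes "wf_conf p q a b" "\<And>i. (i, j) \<notin> alt_faces p q b" "i \<le> p" "j < q"
  shows "a i j = a 0 j"
  by (rule col_const) (use assms in auto)

lemma row_one_face:
  assumes wf: "wf_conf p q a b" and f: "\<And>j. (i, j) \<in> alt_faces p q b \<longleftrightarrow> j = c" and "j \<le> q"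
  shows "b i j = ((j \<le> c) = b i c)"
proof -
  have "(i, c) \<in> alt_faces p q b" using f by simp
  note D = alt_facesD[OF wf this]
  show ?thesis
  proof (cases "j \<le> c")
    case True
    have "b i c = b i j" by (rule row_const[where q = q]) (use True D f in auto)
    then show ?thesis using True by simp
  next
    case False
    have "b i j = b i (Suc c)" by (rule row_const[where q = q]) (use False D f assms in auto)
    then show ?thesis using False D by simp
  qed
qed

lemma col_one_face:
  assumes wf: "wf_conf p q a b" and f: "\<And>i. (i, j) \<in> alt_faces p q b \<longleftrightarrow> i = r" and "i \<le> p"
  shows "a i j = ((i \<le> r) = b r j)"
proof -
  have "(r, j) \<in> alt_faces p q b" using f by simp
  note D = alt_facesD[OF wf this]
  show ?thesis
  proof (cases "i \<le> r")
    case True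
    have "a r j = a i j" by (rule col_const[OF wf]) (use True D f in auto)
    then show ?thesis using True D by simp
  next
    case False
    have "a i j = a (Suc r) j" by (rule col_const[OF wf]) (use False D f assms in auto)
    then show ?thesis using False D by simp
  qed
qed

section \<open>Counting the patterns with five extrema\<close>

definition tuples0 :: "nat \<Rightarrow> nat \<Rightarrow> (bool list \<times> bool list) set" where
  "tuples0 p q = {(\<beta>, \<alpha>). length \<beta> = p \<and> length \<alpha> = q \<and>
     Suc (asc \<beta>) * Suc (asc \<alpha>) + Suc (desc \<beta>) * Suc (desc \<alpha>) = 5}"

text \<open>Without alternating squares all rows carry one word and all columns carry one
  word.\<close>

lemma bij_confs5_0:
  assumes "0 < p" "0 < q"
  shows "bij_betw (conf0 p q) (tuples0 p q) (confs5 p q 0)"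
  unfolding bij_betw_def
proof (intro conjI equalityI subsetI)
  show "inj_on (conf0 p q) (tuples0 p q)"
    by (rule inj_onI) (auto simp: conf0_def tuples0_def dest: prof_conf_inj)
next
  fix x assume "x \<in> conf0 p q ` tuples0 p q"
  then obtain \<beta> \<alpha> where x: "x = conf0 p q (\<beta>, \<alpha>)" and t: "(\<beta>, \<alpha>) \<in> tuples0 p q" by auto
  obtain a b where ab: "conf0 p q (\<beta>, \<alpha>) = (a, b)" by (cases "conf0 p q (\<beta>, \<alpha>)") 
  have "(a, b) \<in> confs p q" unfolding ab[symmetric] conf0_def by (auto intro: prof_conf_in_confs)
  moreover have "alt_faces p q b = {}"
    using ab unfolding conf0_def by (auto simp: alt_faces_prof)
  moreover have "num_ext p q a b = 5"
    using num_ext_conf0[OF _ _ assms(1) ab] t by (auto simp: tuples0_def)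
  ultimately show "x \<in> confs5 p q 0" by (simp add: x ab confs5_def)
next
  fix x assume "x \<in> confs5 p q 0"
  then obtain a b where x: "x = (a, b)" "(a, b) \<in> confs p q" "alt_faces p q b = {}" "num_ext p q a b = 5"
    by (auto simp: confs5_def)
  let ?t = "(map (\<lambda>i. b i 0) [0..<p], map (\<lambda>j. a 0 j) [0..<q])"
  have eq: "(a, b) = conf0 p q ?t"
    unfolding conf0_def prod.case
  proof (rule prof_conf_eqI[OF x(2)])
    fix i j assume "i \<le> p" "j < q"
    then show "a i j = (map (a 0) [0..<q] ! j = True)"
      using col_no_face[OF confs_wf[OF x(2)], of j i] x(3) by simp
  next
    fix i j assume "i < p" "j \<le> q"
    then show "b i j = (map (\<lambda>i. b i 0) [0..<p] ! i = True)"
      using row_no_face[of i p q b j] x(3) by simp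
  qed
  have "?t \<in> tuples0 p q"
    using num_ext_conf0[OF _ _ assms(1) eq[symmetric]] x(4) by (auto simp: tuples0_def)
  with eq x(1) show "x \<in> conf0 p q ` tuples0 p q" by blast
qed

text \<open>The words are read off column 0 and row 0 with the letter of the square left out, hence
  the total lengths \<open>P\<close> and \<open>Q\<close>. Injectivity first recovers the position
  and the type of the square.\<close>

lemma bij_confs5_1:
  "bij_betw (conf1 (Suc P) (Suc Q)) (UNIV \<times> quad_tuples P Q 5) (confs5 (Suc P) (Suc Q) 1)"
  unfolding bij_betw_def
proof (intro conjI equalityI subsetI)
  let ?p = "Suc P" and ?q = "Suc Q"
  have alt: "alt_faces ?p ?q b = {(length u, length l)} \<and> b (length u) (length l) = s"
    if "conf1 ?p ?q (s, (u, d), (l, w)) = (a, b)" "length u + length d = P" "length l + length w = Q" for s u d l w a b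
  proof
    show "alt_faces ?p ?q b = {(length u, length l)}"
      using that unfolding conf1_def prod.case
      by (simp only: alt_faces_prof nth_middle_neq le_neq_Suc_le) auto
    show "b (length u) (length l) = s" using that by (auto simp: conf1_def prof_conf_def)
  qed
  show "inj_on (conf1 ?p ?q) (UNIV \<times> quad_tuples P Q 5)"
  proof (rule inj_onI)
    fix x y assume "x \<in> UNIV \<times> quad_tuples P Q 5" "y \<in> UNIV \<times> quad_tuples P Q 5"
      and e: "conf1 ?p ?q x = conf1 ?p ?q y"
    then obtain s u d l w s' u' d' l' w' where xy: "x = (s, (u, d), (l, w))" "y = (s', (u', d'), (l', w'))"
      and len: "length u + length d = P" "length l + length w = Q" "length u' + length d' = P" "length l' + length w' = Q"
      by (auto simp: quad_tuples_def wpairs_def)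
    obtain a b where ab: "conf1 ?p ?q x = (a, b)" by (cases "conf1 ?p ?q x")
    from alt[OF ab[unfolded xy] len(1,2)] alt[OF ab[unfolded e, unfolded xy] len(3,4)]
    have *: "length u = length u'" "length l = length l'" "s = s'" by auto
    have "l @ (0 \<le> length u) # w = l' @ (0 \<le> length u') # w'" "u @ (0 \<le> length l) # d = u' @ (0 \<le> length l') # d'"
      using prof_conf_inj[OF e[unfolded xy conf1_def prod.case, folded *(3)]] len by auto
    then show "x = y" using * by (simp add: xy)
  qed
next
  let ?p = "Suc P" and ?q = "Suc Q"
  fix x assume "x \<in> conf1 ?p ?q ` (UNIV \<times> quad_tuples P Q 5)"
  then obtain s u d l w where x: "x = conf1 ?p ?q (s, (u, d), (l, w))" and q: "quad u d l w = 5"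
    and len: "length u + length d = P" "length l + length w = Q"
    by (auto simp: quad_tuples_def wpairs_def)
  obtain a b where ab: "conf1 ?p ?q (s, (u, d), (l, w)) = (a, b)" by (cases "conf1 ?p ?q (s, (u, d), (l, w))")
  have "(a, b) \<in> confs ?p ?q" unfolding ab[symmetric] conf1_def prod.case
    by (rule prof_conf_in_confs) (auto simp: nth_append nth_Cons')
  moreover have "alt_faces ?p ?q b = {(length u, length l)}"
    using ab len unfolding conf1_def prod.case
    by (simp only: alt_faces_prof nth_middle_neq le_neq_Suc_le) auto
  moreover have "num_ext ?p ?q a b = 5"
    using num_ext_conf1[OF _ _ ab] len q by auto
  ultimately show "x \<in> confs5 ?p ?q 1" by (simp add: x ab confs5_def)
next
  let ?p = "Suc P" and ?q = "Suc Q"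
  fix x assume "x \<in> confs5 ?p ?q 1"
  then obtain a b where x: "x = (a, b)" "(a, b) \<in> confs ?p ?q" "card (alt_faces ?p ?q b) = 1" "num_ext ?p ?q a b = 5"
    by (auto simp: confs5_def)
  note wf = confs_wf[OF x(2)]
  obtain r c where A: "alt_faces ?p ?q b = {(r, c)}" using x(3) by (auto simp: card_1_singleton_iff)
  then have rc: "r < ?p" "c < ?q" by (auto simp: alt_faces_def)
  define s where "s = b r c"
  define u where "u = map (\<lambda>i. b i 0 = s) [0..<r]"
  define d where "d = map (\<lambda>i. b (Suc r + i) 0 = s) [0..<P - r]"
  define l where "l = map (\<lambda>j. a 0 j = s) [0..<c]"
  define w where "w = map (\<lambda>j. a 0 (Suc c + j) = s) [0..<Q - c]"
  have len: "length u = r" "length l = c" "length d = P - r" "length w = Q - c"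
    by (simp_all add: u_def l_def d_def w_def)
  have U: "(u @ z # d) ! i = (if i = r then z else b i 0 = s)" if "i < ?p" for i z
    using that by (auto simp: nth_append nth_Cons' len u_def d_def)
  have L: "(l @ z # w) ! j = (if j = c then z else a 0 j = s)" if "j < ?q" for j z
    using that by (auto simp: nth_append nth_Cons' len l_def w_def)
  have eq: "(a, b) = conf1 ?p ?q (s, (u, d), (l, w))"
    unfolding conf1_def prod.case
  proof (rule prof_conf_eqI[OF x(2)])
    fix i j assume "i \<le> ?p" "j < ?q"
    then show "a i j = ((l @ (i \<le> length u) # w) ! j = s)"
      using col_no_face[OF wf, of j i] col_one_face[OF wf, of j r i] A by (cases "j = c") (auto simp: L len s_def)
  next
    fix i j assume "i < ?p" "j \<le> ?q"
    then show "b i j = ((u @ (j \<le> length l) # d) ! i = s)"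
      using row_no_face[of i ?p ?q b j] row_one_face[OF wf, of i c j] A by (cases "i = r") (auto simp: U len s_def)
  qed
  have "((u, d), (l, w)) \<in> quad_tuples P Q 5"
    using num_ext_conf1[OF _ _ eq[symmetric]] x(4) rc by (auto simp: quad_tuples_def wpairs_def len)
  with eq x(1) show "x \<in> conf1 ?p ?q ` (UNIV \<times> quad_tuples P Q 5)" by blast
qed

lemma alt_faces_conf2:
  assumes "conf2 (Suc (Suc P)) (Suc (Suc Q)) (s, t, (u, d), (l, w)) = (a, b)"
    "length u + length d = P" "length l + length w = Q"
  defines "r \<equiv> length u" and "c \<equiv> length l"
  shows "alt_faces (Suc (Suc P)) (Suc (Suc Q)) b = (if t then {(r, c), (Suc r, Suc c)} else {(r, Suc c), (Suc r, c)})"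
    "b r c = s"
proof -
  show "alt_faces (Suc (Suc P)) (Suc (Suc Q)) b = (if t then {(r, c), (Suc r, Suc c)} else {(r, Suc c), (Suc r, c)})"
    using assms(1-3) unfolding conf2_def prod.case r_def c_def
    by (simp only: alt_faces_prof nth_middle2_neq le_neq_Suc_le) auto
  show "b r c = s" using assms(1-3) by (cases t) (auto simp: conf2_def prof_conf_def r_def c_def)
qed

text \<open>The value 4 instead of 5 is due to the extremum where the squares touch; two letters of
  each line are left out.\<close>

lemma bij_confs5_2:
  "bij_betw (conf2 (Suc (Suc P)) (Suc (Suc Q))) (UNIV \<times> UNIV \<times> quad_tuples P Q 4) (confs5 (Suc (Suc P)) (Suc (Suc Q)) 2)"
  unfolding bij_betw_def
proof (intro conjI equalityI subsetI)
  let ?p = "Suc (Suc P)" and ?q = "Suc (Suc Q)"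
  show "inj_on (conf2 ?p ?q) (UNIV \<times> UNIV \<times> quad_tuples P Q 4)"
  proof (rule inj_onI)
    fix x y assume "x \<in> UNIV \<times> UNIV \<times> quad_tuples P Q 4" "y \<in> UNIV \<times> UNIV \<times> quad_tuples P Q 4"
      and e: "conf2 ?p ?q x = conf2 ?p ?q y"
    then obtain s t u d l w s' t' u' d' l' w' where xy: "x = (s, t, (u, d), (l, w))" "y = (s', t', (u', d'), (l', w'))"
      and len: "length u + length d = P" "length l + length w = Q" "length u' + length d' = P" "length l' + length w' = Q"
      by (auto simp: quad_tuples_def wpairs_def)
    obtain a b where ab: "conf2 ?p ?q x = (a, b)" by (cases "conf2 ?p ?q x")
    note A = alt_faces_conf2[OF ab[unfolded xy] len(1,2)] alt_faces_conf2[OF ab[unfolded e, unfolded xy] len(3,4)]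
    have *: "length u = length u' \<and> length l = length l' \<and> t = t'"
      using trans[OF A(1)[symmetric] A(3)] by (cases t; cases t') (auto simp: doubleton_eq_iff)
    with A(2,4) have s: "s = s'" by simp
    have "l @ True # True # w = l' @ True # True # w'" "u @ True # True # d = u' @ True # True # d'"
      using prof_conf_inj[OF e[unfolded xy conf2_def prod.case, folded s]] len by auto
    then show "x = y" using * s by (simp add: xy)
  qed
next
  let ?p = "Suc (Suc P)" and ?q = "Suc (Suc Q)"
  fix x assume "x \<in> conf2 ?p ?q ` (UNIV \<times> UNIV \<times> quad_tuples P Q 4)"
  then obtain s t u d l w where x: "x = conf2 ?p ?q (s, t, (u, d), (l, w))" and q: "quad u d l w = 4"
    and len: "length u + length d = P" "length l + length w = Q"
    by (auto simp: quad_tuples_def wpairs_def)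
  obtain a b where ab: "conf2 ?p ?q (s, t, (u, d), (l, w)) = (a, b)" by (cases "conf2 ?p ?q (s, t, (u, d), (l, w))")
  have "(a, b) \<in> confs ?p ?q" unfolding ab[symmetric] conf2_def prod.case
    by (rule prof_conf_in_confs) (auto simp: nth_append nth_Cons')
  moreover have "card (alt_faces ?p ?q b) = 2"
    by (simp add: alt_faces_conf2(1)[OF ab len])
  moreover have "num_ext ?p ?q a b = 5"
    using num_ext_conf2[OF _ _ ab] len q by auto
  ultimately show "x \<in> confs5 ?p ?q 2" by (simp add: x ab confs5_def)
next
  let ?p = "Suc (Suc P)" and ?q = "Suc (Suc Q)"
  fix x assume "x \<in> confs5 ?p ?q 2"
  then obtain a b where x: "x = (a, b)" "(a, b) \<in> confs ?p ?q" "card (alt_faces ?p ?q b) = 2" "num_ext ?p ?q a b = 5"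
    by (auto simp: confs5_def)
  note wf = confs_wf[OF x(2)]
  \<comment> \<open>Five extrema and two alternating squares leave 10 - 4 - 2 changes.\<close>
  have chg: "chg (boundary_word ?p ?q a b) \<le> 4"
    using euler_inequality[OF wf] x(3,4) by simp
  obtain r c t where rc: "Suc r < ?p" "Suc c < ?q"
    and A: "alt_faces ?p ?q b = (if t then {(r, c), (Suc r, Suc c)} else {(r, Suc c), (Suc r, c)})"
    and same: "b (Suc r) (if t then Suc c else c) = b r (if t then c else Suc c)"
  proof (rule two_alt_faces[OF wf x(3) chg])
    fix r c assume "Suc r < ?p" "Suc c < ?q" "alt_faces ?p ?q b = {(r, c), (Suc r, Suc c)}" "b (Suc r) (Suc c) = b r c"
    then show thesis by (intro that[of r c True]) simp_all
  next
    fix r c assume "Suc r < ?p" "Suc c < ?q" "alt_faces ?p ?q b = {(r, Suc c), (Suc r, c)}" "b (Suc r) c = b r (Suc c)"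
    then show thesis by (intro that[of r c False]) simp_all
  qed
  define s where "s = b r (if t then c else Suc c)"
  define u where "u = map (\<lambda>i. b i 0 = s) [0..<r]"
  define d where "d = map (\<lambda>i. b (Suc (Suc r) + i) 0 = s) [0..<P - r]"
  define l where "l = map (\<lambda>j. a 0 j = s) [0..<c]"
  define w where "w = map (\<lambda>j. a 0 (Suc (Suc c) + j) = s) [0..<Q - c]"
  have len: "length u = r" "length l = c" "length d = P - r" "length w = Q - c"
    by (simp_all add: u_def l_def d_def w_def)
  have split: "i < r \<or> i = r \<or> i = Suc r \<or> (\<exists>k. i = Suc (Suc (r + k)))" for i r :: nat
    by (metis add_Suc less_imp_Suc_add linorder_cases not_less_eq)
  have U: "(u @ z # z' # d) ! i = (if i = r then z else if i = Suc r then z' else b i 0 = s)" if "i < ?p" for i z z'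
    using split[of i r] that by (elim disjE exE) (simp_all add: nth_append len, simp_all add: u_def d_def less_diff_conv add.commute)
  have L: "(l @ z # z' # w) ! j = (if j = c then z else if j = Suc c then z' else a 0 j = s)" if "j < ?q" for j z z'
    using split[of j c] that by (elim disjE exE) (simp_all add: nth_append len, simp_all add: l_def w_def less_diff_conv add.commute)
  have eq: "(a, b) = conf2 ?p ?q (s, t, (u, d), (l, w))"
    unfolding conf2_def prod.case
  proof (rule prof_conf_eqI[OF x(2)])
    fix i j assume ij: "i \<le> ?p" "j < ?q"
    consider "j = c" | "j = Suc c" | "j \<noteq> c" "j \<noteq> Suc c" by blast
    then show "a i j = ((l @ (i \<le> (if t then length u else Suc (length u))) #
        (i \<le> (if t then Suc (length u) else length u)) # w) ! j = s)"
    proof cases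
      case 1
      then show ?thesis using ij col_one_face[OF wf, of j "if t then r else Suc r" i] A same
        by (cases t) (auto simp: L len s_def)
    next
      case 2
      then show ?thesis using ij col_one_face[OF wf, of j "if t then Suc r else r" i] A same
        by (cases t) (auto simp: L len s_def)
    next
      case 3
      then show ?thesis using ij col_no_face[OF wf, of j i] A
        by (cases t) (auto simp: L len s_def)
    qed
  next
    fix i j assume ij: "i < ?p" "j \<le> ?q"
    consider "i = r" | "i = Suc r" | "i \<noteq> r" "i \<noteq> Suc r" by blast
    then show "b i j = ((u @ (j \<le> (if t then length l else Suc (length l))) #
        (j \<le> (if t then Suc (length l) else length l)) # d) ! i = s)"
    proof cases
      case 1
      then show ?thesis using ij row_one_face[OF wf, of i "if t then c else Suc c" j] A same
        by (cases t) (auto simp: U len s_def)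
    next
      case 2
      then show ?thesis using ij row_one_face[OF wf, of i "if t then Suc c else c" j] A same
        by (cases t) (auto simp: U len s_def)
    next
      case 3
      then show ?thesis using ij row_no_face[of i ?p ?q b j] A
        by (cases t) (auto simp: U len s_def)
    qed
  qed
  have "((u, d), (l, w)) \<in> quad_tuples P Q 4"
    using num_ext_conf2[OF _ _ eq[symmetric]] x(4) rc by (auto simp: quad_tuples_def wpairs_def len)
  with eq x(1) show "x \<in> conf2 ?p ?q ` (UNIV \<times> UNIV \<times> quad_tuples P Q 4)" by blast
qed

lemma card_tuples0:
  "card (tuples0 (Suc P) (Suc Q)) = 4 * (P choose 3) + 4 * (Q choose 3) + 2 * P * Q"
proof -
  let ?W = "\<lambda>P h c. {x. length x = Suc P \<and> hd x = h \<and> chg x = c}"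
  \<comment> \<open>Expanded, the sum is 2 plus both numbers of changes plus
    \<open>asc \<beta> * asc \<alpha> + desc \<beta> * desc \<alpha>\<close>. It is 5 if one word is
    constant and the other has three changes, or if each has one change, of the same kind. One
    change against two gives 6, because the product terms contribute 1.\<close>
  define I :: "(bool \<times> bool \<times> nat \<times> nat) set" where "I = {(True, True, 0, 3), (True, False, 0, 3), (False, True, 0, 3), (False, False, 0, 3),
      (True, True, 3, 0), (True, False, 3, 0), (False, True, 3, 0), (False, False, 3, 0),
      (True, True, 1, 1), (False, False, 1, 1)}"
  have fin: "finite (?W P h c)" for P h c
    by (rule finite_subset[OF _ finite_words]) auto
  have "tuples0 (Suc P) (Suc Q) = (\<Union>(h, g, x, y)\<in>I. ?W P h x \<times> ?W Q g y)"
  proof -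
    have "Suc (asc \<beta>) * Suc (asc \<alpha>) + Suc (desc \<beta>) * Suc (desc \<alpha>) = 5 \<longleftrightarrow>
      (hd \<beta>, hd \<alpha>, chg \<beta>, chg \<alpha>) \<in> I" if len: "length \<beta> = Suc P" "length \<alpha> = Suc Q" for \<alpha> \<beta>
    proof -
      have ad: "asc \<beta> = (chg \<beta> + of_bool (\<not> hd \<beta>)) div 2" "desc \<beta> = (chg \<beta> + of_bool (hd \<beta>)) div 2"
        "asc \<alpha> = (chg \<alpha> + of_bool (\<not> hd \<alpha>)) div 2" "desc \<alpha> = (chg \<alpha> + of_bool (hd \<alpha>)) div 2"
        using len by (cases \<beta>; cases \<alpha>; simp add: asc_eq desc_eq)+
      show ?thesis
      proof (cases "chg \<beta> \<le> 3 \<and> chg \<alpha> \<le> 3")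
        case True
        then have "chg \<beta> \<in> {0,1,2,3}" "chg \<alpha> \<in> {0,1,2,3}" by auto
        then show ?thesis unfolding ad I_def by (cases "hd \<beta>"; cases "hd \<alpha>") auto
      next
        case False
        then have "(hd \<beta>, hd \<alpha>, chg \<beta>, chg \<alpha>) \<notin> I" by (auto simp: I_def)
        moreover have "5 < Suc (asc \<beta>) * Suc (asc \<alpha>) + Suc (desc \<beta>) * Suc (desc \<alpha>)"
          using False by (auto simp: chg_def algebra_simps)
        ultimately show ?thesis by auto
      qed
    qed
    then have "(\<beta>, \<alpha>) \<in> tuples0 (Suc P) (Suc Q) \<longleftrightarrow>
        length \<beta> = Suc P \<and> length \<alpha> = Suc Q \<and> (hd \<beta>, hd \<alpha>, chg \<beta>, chg \<alpha>) \<in> I" for \<alpha> \<beta>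
      unfolding tuples0_def mem_Collect_eq prod.case by blast
    then have "tuples0 (Suc P) (Suc Q) =
        {(\<beta>, \<alpha>). length \<beta> = Suc P \<and> length \<alpha> = Suc Q \<and> (hd \<beta>, hd \<alpha>, chg \<beta>, chg \<alpha>) \<in> I}"
      unfolding set_eq_iff split_paired_All mem_Collect_eq prod.case by (intro allI)
    moreover have "{(\<beta>, \<alpha>). length \<beta> = Suc P \<and> length \<alpha> = Suc Q \<and> (hd \<beta>, hd \<alpha>, chg \<beta>, chg \<alpha>) \<in> X} =
        (\<Union>(h, g, x, y)\<in>X. ?W P h x \<times> ?W Q g y)" for X
      by auto
    ultimately show ?thesis by (simp only:)
  qed
  also have "card \<dots> = (\<Sum>(h, g, x, y)\<in>I. card (?W P h x \<times> ?W Q g y))"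
  proof -
    have *: "card (\<Union>(h, g, x, y)\<in>X. ?W P h x \<times> ?W Q g y) = (\<Sum>(h, g, x, y)\<in>X. card (?W P h x \<times> ?W Q g y))"
      if "finite X" for X
      using that by (subst card_UN_disjoint) (auto simp: fin case_prod_unfold)
    show ?thesis by (rule *) (simp add: I_def)
  qed
  also have "\<dots> = 4 * (P choose 3) + 4 * (Q choose 3) + 2 * P * Q"
    unfolding card_cartesian_product card_words by (simp add: I_def)
  finally show ?thesis .
qed

text \<open>The three lines of the sum belong to 0, 1 and 2 alternating squares. The factor 2 is the
  type of the square; the factor 4 is the common type and the choice of diagonal or
  antidiagonal.\<close>

lemma card_confs_5:
  assumes "3 \<le> p" "3 \<le> q"
  shows "card {(a, b) \<in> confs p q. num_ext p q a b = 5} =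
    4 * ((p - 1) choose 3) + 4 * ((q - 1) choose 3) + 2 * (p - 1) * (q - 1) +
    2 * (20 * (p - 2) * (q - 2) + 16 * (p - 2) + 16 * (q - 2) + 4 + 8 * ((p - 2) choose 2) + 8 * ((q - 2) choose 2)) +
    4 * (2 * (p - 3) * (q - 3) + 8 * (p - 3) + 8 * (q - 3) + 12)"
proof -
  obtain P Q where PQ: "p = Suc (Suc (Suc P))" "q = Suc (Suc (Suc Q))"
    using assms by (metis Suc_le_D numeral_3_eq_3 Suc_le_mono)
  have fin: "finite (quad_tuples A B k)" for A B k
    by (rule finite_subset[of _ "wpairs A \<times> wpairs B"]) (auto simp: quad_tuples_def)
  have fin0: "finite (tuples0 p q)"
    by (rule finite_subset[OF _ finite_cartesian_product[OF finite_words[of p] finite_words[of q]]])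
      (auto simp: tuples0_def)
  have "{(a, b) \<in> confs p q. num_ext p q a b = 5} = confs5 p q 0 \<union> confs5 p q 1 \<union> confs5 p q 2"
  proof -
    have "card (alt_faces p q b) \<le> 2" if "(a, b) \<in> confs p q" "num_ext p q a b = 5" for a b
    proof (cases "alt_faces p q b = {}")
      case False
      then show ?thesis
        using euler_inequality[OF confs_wf[OF that(1)]] chg_boundary_ge_3[OF confs_wf[OF that(1)] False] that(2) assms
        by simp
    qed simp
    then have "card (alt_faces p q b) \<in> {0, 1, 2}" if "(a, b) \<in> confs p q" "num_ext p q a b = 5" for a b
      using that by fastforce
    then show ?thesis by (auto simp: confs5_def)
  qed
  moreover have F: "finite (confs5 p q 0)" "finite (confs5 p q 1)" "finite (confs5 p q 2)"
    using bij_betw_finite[OF bij_confs5_0[of p q]] bij_betw_finite[OF bij_confs5_1[of "Suc (Suc P)" "Suc (Suc Q)"]]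
      bij_betw_finite[OF bij_confs5_2[of "Suc P" "Suc Q"]] assms fin fin0 by (auto simp: PQ)
  moreover have "card (confs5 p q 0 \<union> confs5 p q 1 \<union> confs5 p q 2) = card (confs5 p q 0) + card (confs5 p q 1) + card (confs5 p q 2)"
    using F by (subst card_Un_disjoint; (subst card_Un_disjoint)?) (auto simp: confs5_def)
  moreover have "card (confs5 p q 0) = card (tuples0 p q)"
    using bij_betw_same_card[OF bij_confs5_0[of p q]] assms by simp
  moreover have "card (confs5 p q 1) = 2 * card (quad_tuples (Suc (Suc P)) (Suc (Suc Q)) 5)"
    using bij_betw_same_card[OF bij_confs5_1[of "Suc (Suc P)" "Suc (Suc Q)"]] by (simp add: PQ card_cartesian_product)
  moreover have "card (confs5 p q 2) = 4 * card (quad_tuples (Suc P) (Suc Q) 4)"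
    using bij_betw_same_card[OF bij_confs5_2[of "Suc P" "Suc Q"]] by (simp add: PQ card_cartesian_product)
  ultimately show ?thesis
    by (simp add: card_quad_4 card_quad_5 card_tuples0 PQ)
qed

section \<open>Colourings and sign patterns\<close>

lemma three_cases: fixes x :: 3 obtains "x = 0" | "x = 1" | "x = -1"
proof (cases x)
  case (of_int z)
  then have "z = 0 \<or> z = 1 \<or> z = 2" by auto
  moreover have "(2::3) = -1" by simp
  ultimately show ?thesis using that of_int by auto
qed

text \<open>The three colours sum to 0 modulo 3.\<close>

lemma third_colour:
  fixes x y z :: 3
  shows "x \<noteq> y \<Longrightarrow> - x - y \<noteq> x" "x \<noteq> y \<Longrightarrow> - x - y \<noteq> y" "x \<noteq> y \<Longrightarrow> z \<noteq> x \<Longrightarrow> z \<noteq> y \<Longrightarrow> z = - x - y"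
  by (cases x rule: three_cases; cases y rule: three_cases; cases z rule: three_cases; simp)+

definition step :: "bool \<Rightarrow> 3" where "step x = (if x then 1 else -1)"

lemma step_inject [simp]: "step x = step y \<longleftrightarrow> x = y"
  by (simp add: step_def)

lemma step_nonzero [simp]: "step x \<noteq> 0"
  by (simp add: step_def)

lemma minus_step: "- step x = step (\<not> x)"
  by (simp add: step_def)

lemma step_add_eq: "step x + step y = step z + step w \<longleftrightarrow> of_bool x + of_bool y = (of_bool z + of_bool w :: nat)"
  by (cases x; cases y; cases z; cases w) (simp_all add: step_def)

lemma neq_step: "x \<noteq> y \<Longrightarrow> y = x + step (y = x + 1)"
  by (cases x rule: three_cases; cases y rule: three_cases; simp add: step_def)

text \<open>Grid vertices are counted from 1 and sign indices from 0, hence the \<open>Suc\<close>;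
  a line of \<open>Suc p\<close> vertices has \<open>p\<close> edges.\<close>

definition conf_of :: "nat \<Rightarrow> nat \<Rightarrow> colouring \<Rightarrow> (nat \<Rightarrow> nat \<Rightarrow> bool) \<times> (nat \<Rightarrow> nat \<Rightarrow> bool)" where
  "conf_of p q c =
     (\<lambda>i j. i \<le> p \<and> j < q \<and> c (Suc i, Suc (Suc j)) = c (Suc i, Suc j) + 1,
      \<lambda>i j. i < p \<and> j \<le> q \<and> c (Suc (Suc i), Suc j) = c (Suc i, Suc j) + 1)"

text \<open>Adds the steps along the path down the first column and then along the row. Starting
  with colour 0 selects one colouring of each orbit.\<close>

definition colouring_of :: "nat \<Rightarrow> nat \<Rightarrow> (nat \<Rightarrow> nat \<Rightarrow> bool) \<times> (nat \<Rightarrow> nat \<Rightarrow> bool) \<Rightarrow> colouring" where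
  "colouring_of p q = (\<lambda>(a, b). \<lambda>v\<in>grid_verts (Suc p) (Suc q).
     (\<Sum>k<fst v - 1. step (b k 0)) + (\<Sum>k<snd v - 1. step (a (fst v - 1) k)))"

lemma grid_verts_iff: "v \<in> grid_verts (Suc p) (Suc q) \<longleftrightarrow> (\<exists>i\<le>p. \<exists>j\<le>q. v = (Suc i, Suc j))"
proof (cases v)
  case (Pair x y)
  show ?thesis
  proof
    assume "v \<in> grid_verts (Suc p) (Suc q)"
    then have "x - 1 \<le> p" "y - 1 \<le> q" "v = (Suc (x - 1), Suc (y - 1))" using Pair by (auto simp: grid_verts_def)
    then show "\<exists>i\<le>p. \<exists>j\<le>q. v = (Suc i, Suc j)" by blast
  qed (auto simp: grid_verts_def)
qed

lemma grid_adj_iff: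
  assumes "i \<le> p" "j \<le> q"
  shows "grid_adj (Suc p) (Suc q) (Suc i, Suc j) u \<longleftrightarrow>
    0 < i \<and> u = (i, Suc j) \<or> i < p \<and> u = (Suc (Suc i), Suc j) \<or>
    0 < j \<and> u = (Suc i, j) \<or> j < q \<and> u = (Suc i, Suc (Suc j))"
  using assms by (cases u) (auto simp: grid_adj_def grid_verts_def)

lemma grid_adj_sym: "grid_adj m n u v \<Longrightarrow> grid_adj m n v u"
  by (auto simp: grid_adj_def)

lemma grid_adj_verts: "grid_adj m n u v \<Longrightarrow> u \<in> grid_verts m n \<and> v \<in> grid_verts m n \<and> u \<noteq> v"
  by (auto simp: grid_adj_def)

lemma proper_neq: "c \<in> proper_colourings m n \<Longrightarrow> grid_adj m n u v \<Longrightarrow> c u \<noteq> c v"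
  unfolding proper_colourings_def by blast

lemma proper_outside: "c \<in> proper_colourings m n \<Longrightarrow> v \<notin> grid_verts m n \<Longrightarrow> c v = undefined"
  unfolding proper_colourings_def PiE_iff extensional_def by blast

lemma proper_colouringsI:
  assumes "\<And>v. v \<notin> grid_verts m n \<Longrightarrow> c v = undefined" "\<And>u v. grid_adj m n u v \<Longrightarrow> c u \<noteq> c v"
  shows "c \<in> proper_colourings m n"
  using assms unfolding proper_colourings_def PiE_iff extensional_def by blast

lemma proper_step:
  assumes "c \<in> proper_colourings (Suc p) (Suc q)" "conf_of p q c = (a, b)"
  shows "i \<le> p \<Longrightarrow> j < q \<Longrightarrow> c (Suc i, Suc (Suc j)) = c (Suc i, Suc j) + step (a i j)"
    "i < p \<Longrightarrow> j \<le> q \<Longrightarrow> c (Suc (Suc i), Suc j) = c (Suc i, Suc j) + step (b i j)"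
proof -
  have P: "grid_adj (Suc p) (Suc q) u v \<Longrightarrow> c u \<noteq> c v" for u v
    using proper_neq[OF assms(1)] .
  show "c (Suc i, Suc (Suc j)) = c (Suc i, Suc j) + step (a i j)" if "i \<le> p" "j < q"
    using neq_step[OF P[of "(Suc i, Suc j)" "(Suc i, Suc (Suc j))"]] that assms(2)
    by (auto simp: grid_adj_iff conf_of_def)
  show "c (Suc (Suc i), Suc j) = c (Suc i, Suc j) + step (b i j)" if "i < p" "j \<le> q"
    using neq_step[OF P[of "(Suc i, Suc j)" "(Suc (Suc i), Suc j)"]] that assms(2)
    by (auto simp: grid_adj_iff conf_of_def)
qed

text \<open>The closing condition: both paths around a square to its opposite corner give the same
  colour.\<close>

lemma wf_conf_iff:
  "wf_conf p q a b \<longleftrightarrow> (\<forall>i<p. \<forall>j<q. step (b i j) + step (a (Suc i) j) = step (a i j) + step (b i (Suc j)))"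
proof -
  have "(b i j = b i (Suc j) \<and> a i j = a (Suc i) j \<or>
     b i j = a i j \<and> b i (Suc j) = (\<not> b i j) \<and> a (Suc i) j = (\<not> a i j)) \<longleftrightarrow>
     step (b i j) + step (a (Suc i) j) = step (a i j) + step (b i (Suc j))" for i j
    unfolding step_add_eq by (cases "b i j"; cases "a i j"; cases "b i (Suc j)"; cases "a (Suc i) j") simp_all
  then show ?thesis by (simp only: wf_conf_def)
qed

lemma conf_of_in_confs:
  assumes "c \<in> proper_colourings (Suc p) (Suc q)"
  shows "conf_of p q c \<in> confs p q"
proof -
  obtain a b where ab: "conf_of p q c = (a, b)" by (cases "conf_of p q c")
  note S = proper_step[OF assms ab]
  have "step (b i j) + step (a (Suc i) j) = step (a i j) + step (b i (Suc j))" if "i < p" "j < q" for i j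
  proof -
    have "c (Suc i, Suc j) + step (b i j) + step (a (Suc i) j) = c (Suc (Suc i), Suc (Suc j))"
      using S(1)[of "Suc i" j] S(2)[of i j] that by simp
    also have "\<dots> = c (Suc i, Suc j) + step (a i j) + step (b i (Suc j))"
      using S(1)[of i j] S(2)[of i "Suc j"] that by simp
    finally show ?thesis by (simp add: add.assoc)
  qed
  then show ?thesis using ab by (auto simp: confs_def wf_conf_iff conf_of_def)
qed

lemma colouring_of_eq:
  "i \<le> p \<Longrightarrow> j \<le> q \<Longrightarrow> colouring_of p q (a, b) (Suc i, Suc j) = (\<Sum>k<i. step (b k 0)) + (\<Sum>k<j. step (a i k))"
  by (simp add: colouring_of_def grid_verts_def)

text \<open>Horizontal steps hold by construction. A vertical step off the first column follows from
  the one to its left by closing the square between them.\<close>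

lemma colouring_of_steps:
  assumes "(a, b) \<in> confs p q"
  defines "c \<equiv> colouring_of p q (a, b)"
  shows "i \<le> p \<Longrightarrow> j < q \<Longrightarrow> c (Suc i, Suc (Suc j)) = c (Suc i, Suc j) + step (a i j)"
    "i < p \<Longrightarrow> j \<le> q \<Longrightarrow> c (Suc (Suc i), Suc j) = c (Suc i, Suc j) + step (b i j)"
proof -
  show *: "c (Suc i, Suc (Suc j)) = c (Suc i, Suc j) + step (a i j)" if "i \<le> p" "j < q" for i j
    using that by (simp add: c_def colouring_of_eq)
  show "c (Suc (Suc i), Suc j) = c (Suc i, Suc j) + step (b i j)" if "i < p" "j \<le> q"
    using that
  proof (induction j)
    case (Suc j)
    have "c (Suc (Suc i), Suc (Suc j)) = c (Suc i, Suc j) + (step (b i j) + step (a (Suc i) j))"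
      using *[of "Suc i" j] Suc by (simp add: add.assoc)
    also have "\<dots> = c (Suc i, Suc j) + (step (a i j) + step (b i (Suc j)))"
      using assms(1) Suc.prems by (simp add: confs_def wf_conf_iff)
    also have "\<dots> = c (Suc i, Suc (Suc j)) + step (b i (Suc j))"
      using *[of i j] Suc by (simp add: add.assoc)
    finally show ?case .
  qed (simp add: c_def colouring_of_eq)
qed

lemma colouring_of_proper:
  assumes "x \<in> confs p q"
  shows "colouring_of p q x \<in> proper_colourings (Suc p) (Suc q)"
proof -
  obtain a b where x: "x = (a, b)" by (cases x)
  let ?c = "colouring_of p q (a, b)"
  note S = colouring_of_steps[OF assms[unfolded x]]
  have "?c u \<noteq> ?c v" if adj: "grid_adj (Suc p) (Suc q) u v" for u v
  proof -
    obtain i j where ij: "u = (Suc i, Suc j)" "i \<le> p" "j \<le> q"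
      using grid_adj_verts[OF adj] by (auto simp: grid_verts_iff)
    from adj consider "0 < i" "v = (i, Suc j)" | "i < p" "v = (Suc (Suc i), Suc j)"
      | "0 < j" "v = (Suc i, j)" | "j < q" "v = (Suc i, Suc (Suc j))"
      unfolding ij(1) grid_adj_iff[OF ij(2,3)] by blast
    then show ?thesis
    proof cases
      case 1
      then show ?thesis using S(2)[of "i - 1" j] ij by simp
    next
      case 2
      then show ?thesis using S(2)[of i j] ij by simp
    next
      case 3
      then show ?thesis using S(1)[of i "j - 1"] ij by simp
    next
      case 4
      then show ?thesis using S(1)[of i j] ij by simp
    qed
  qed
  moreover have "?c v = undefined" if "v \<notin> grid_verts (Suc p) (Suc q)" for v
    using that by (simp only: colouring_of_def prod.case restrict_apply if_False)
  ultimately show ?thesis unfolding x by (intro proper_colouringsI)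
qed

lemma conf_of_colouring_of:
  assumes "x \<in> confs p q"
  shows "conf_of p q (colouring_of p q x) = x"
proof -
  obtain a b where x: "x = (a, b)" by (cases x)
  note S = colouring_of_steps[OF assms[unfolded x]]
  have one: "1 = step True" by (simp add: step_def)
  have "(i \<le> p \<and> j < q \<and> colouring_of p q x (Suc i, Suc (Suc j)) = colouring_of p q x (Suc i, Suc j) + 1) = a i j"
    "(i < p \<and> j \<le> q \<and> colouring_of p q x (Suc (Suc i), Suc j) = colouring_of p q x (Suc i, Suc j) + 1) = b i j" for i j
    using S(1)[of i j] S(2)[of i j] assms unfolding x one confs_def by (auto simp del: One_nat_def)
  then show ?thesis by (simp add: conf_of_def x)
qed

section \<open>Rotation orbits\<close>

lemma rotate_apply: "v \<in> grid_verts m n \<Longrightarrow> rotate_colouring m n k c v = c v + k"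
  by (simp add: rotate_colouring_def)

lemma rotate_proper:
  assumes "c \<in> proper_colourings m n"
  shows "rotate_colouring m n k c \<in> proper_colourings m n"
proof (rule proper_colouringsI)
  fix u v assume adj: "grid_adj m n u v"
  show "rotate_colouring m n k c u \<noteq> rotate_colouring m n k c v"
    using grid_adj_verts[OF adj] proper_neq[OF assms adj] by (simp add: rotate_apply)
qed (simp add: rotate_colouring_def)

lemma rotate_rotate: "rotate_colouring m n k (rotate_colouring m n k' c) = rotate_colouring m n (k' + k) c"
  by (rule ext) (simp add: rotate_colouring_def add.assoc)

lemma rotate_0: "c \<in> proper_colourings m n \<Longrightarrow> rotate_colouring m n 0 c = c"
  by (rule ext) (simp add: rotate_colouring_def proper_outside)

lemma self_in_orbit: "c \<in> proper_colourings m n \<Longrightarrow> c \<in> rotation_orbit m n c"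
  unfolding rotation_orbit_def by (metis rangeI rotate_0)

lemma orbit_rotate: "rotation_orbit m n (rotate_colouring m n k c) = rotation_orbit m n c"
proof -
  have "range (\<lambda>k'. rotate_colouring m n (k + k') c) = range (\<lambda>k'. rotate_colouring m n k' c)"
  proof (intro equalityI subsetI)
    fix d assume "d \<in> range (\<lambda>k'. rotate_colouring m n k' c)"
    then obtain k' where "d = rotate_colouring m n (k + (k' - k)) c" by auto
    then show "d \<in> range (\<lambda>k'. rotate_colouring m n (k + k') c)" by blast
  qed auto
  then show ?thesis by (simp add: rotation_orbit_def rotate_rotate)
qed

lemma orbit_eqI: "c' \<in> rotation_orbit m n c \<Longrightarrow> rotation_orbit m n c' = rotation_orbit m n c"
  by (auto simp: rotation_orbit_def[of m n c] orbit_rotate)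

lemma conf_of_rotate: "conf_of p q (rotate_colouring (Suc p) (Suc q) k c) = conf_of p q c"
  by (auto simp: conf_of_def rotate_apply grid_verts_iff fun_eq_iff)

text \<open>Equal steps make the difference of the two colourings constant.\<close>

lemma same_conf_orbit:
  assumes "c \<in> proper_colourings (Suc p) (Suc q)" "c' \<in> proper_colourings (Suc p) (Suc q)"
    and eq: "conf_of p q c = conf_of p q c'"
  shows "c' \<in> rotation_orbit (Suc p) (Suc q) c"
proof -
  obtain a b where ab: "conf_of p q c = (a, b)" by (cases "conf_of p q c")
  note S = proper_step[OF assms(1) ab] proper_step[OF assms(2) ab[unfolded eq]]
  define k where "k = c' (Suc 0, Suc 0) - c (Suc 0, Suc 0)"
  have 1: "c' (Suc i, Suc 0) = c (Suc i, Suc 0) + k" if "i \<le> p" for i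
    using that
  proof (induction i)
    case (Suc i)
    then show ?case using S(2)[of i 0] S(4)[of i 0] by (simp add: ac_simps)
  qed (simp add: k_def)
  have 2: "c' (Suc i, Suc j) = c (Suc i, Suc j) + k" if "i \<le> p" "j \<le> q" for i j
    using that(2)
  proof (induction j)
    case (Suc j)
    then show ?case using S(1)[of i j] S(3)[of i j] that by (simp add: ac_simps)
  qed (use 1 that in simp)
  have "c' = rotate_colouring (Suc p) (Suc q) k c"
  proof
    fix v
    show "c' v = rotate_colouring (Suc p) (Suc q) k c v"
    proof (cases "v \<in> grid_verts (Suc p) (Suc q)")
      case True
      then show ?thesis using 2 by (auto simp: rotate_apply grid_verts_iff)
    next
      case False
      then show ?thesis using proper_outside[OF assms(2)] by (simp add: rotate_colouring_def)
    qed
  qed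
  then show ?thesis by (auto simp: rotation_orbit_def)
qed

section \<open>Flips and degrees\<close>

definition flippable :: "nat \<Rightarrow> nat \<Rightarrow> colouring \<Rightarrow> (nat \<times> nat) set" where
  "flippable m n c = {v \<in> grid_verts m n. \<forall>u u'. grid_adj m n v u \<and> grid_adj m n v u' \<longrightarrow> c u = c u'}"

text \<open>The new colour is the third one. The choice of neighbour is immaterial at a flippable
  vertex, where all neighbours agree.\<close>

definition flip :: "nat \<Rightarrow> nat \<Rightarrow> colouring \<Rightarrow> nat \<times> nat \<Rightarrow> colouring" where
  "flip m n c v = c(v := - c v - c (SOME u. grid_adj m n v u))"

lemma flippableD:
  "v \<in> flippable m n c \<Longrightarrow> grid_adj m n v u \<Longrightarrow> grid_adj m n v u' \<Longrightarrow> c u = c u'"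
  unfolding flippable_def by blast

lemma flip_third:
  assumes "v \<in> flippable m n c" "grid_adj m n v u"
  shows "flip m n c v = c(v := - c v - c u)"
proof -
  have "grid_adj m n v (SOME u. grid_adj m n v u)" using assms(2) by (rule someI)
  then have "c (SOME u. grid_adj m n v u) = c u" using flippableD[OF assms(1) _ assms(2)] by blast
  then show ?thesis by (simp add: flip_def)
qed

lemma ex_adj:
  assumes "0 < p" "0 < q" "v \<in> grid_verts (Suc p) (Suc q)"
  obtains u where "grid_adj (Suc p) (Suc q) v u"
proof -
  obtain i j where ij: "v = (Suc i, Suc j)" "i \<le> p" "j \<le> q" using assms(3) by (auto simp: grid_verts_iff)
  show thesis
    using that[of "(i, Suc j)"] that[of "(Suc (Suc i), Suc j)"] assms ij
    by (cases "i = 0") (auto simp: grid_adj_iff)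
qed

text \<open>At an extremum all steps away from the vertex are equal, which is to say that all its
  neighbours have one colour.\<close>

lemma card_flippable:
  assumes c: "c \<in> proper_colourings (Suc p) (Suc q)" and ab: "conf_of p q c = (a, b)" and pq: "0 < p" "0 < q"
  shows "card (flippable (Suc p) (Suc q) c) = num_ext p q a b"
proof -
  note S = proper_step[OF c ab]
  have key: "extremal p q a b i j \<longleftrightarrow> (Suc i, Suc j) \<in> flippable (Suc p) (Suc q) c" if ij: "i \<le> p" "j \<le> q" for i j
  proof -
    let ?v = "(Suc i, Suc j)"
    have up: "i = Suc i' \<Longrightarrow> c (i, Suc j) = c ?v + step (\<not> b (i - 1) j)" for i'
      using S(2)[of "i - 1" j] ij by (simp add: minus_step[symmetric])
    have left: "j = Suc j' \<Longrightarrow> c (Suc i, j) = c ?v + step (\<not> a i (j - 1))" for j'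
      using S(1)[of i "j - 1"] ij by (simp add: minus_step[symmetric])
    \<comment> \<open>An arbitrary predicate serves three purposes: all neighbours below, all
      neighbours above, and each neighbour one step away.\<close>
    have iff: "(\<forall>u. grid_adj (Suc p) (Suc q) ?v u \<longrightarrow> P (c u)) \<longleftrightarrow>
      (0 < i \<longrightarrow> P (c ?v + step (\<not> b (i - 1) j))) \<and> (i < p \<longrightarrow> P (c ?v + step (b i j))) \<and>
      (0 < j \<longrightarrow> P (c ?v + step (\<not> a i (j - 1)))) \<and> (j < q \<longrightarrow> P (c ?v + step (a i j)))" for P
      unfolding grid_adj_iff[OF ij] using up left S(1)[of i j] S(2)[of i j] ij
      by (cases i; cases j) auto
    have mx: "(is_max p (\<lambda>k. b k j) i \<and> is_max q (a i) j) \<longleftrightarrow>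
        (\<forall>u. grid_adj (Suc p) (Suc q) ?v u \<longrightarrow> c u = c ?v + step False)"
      unfolding iff[of "\<lambda>y. y = c ?v + step False"] add_left_cancel step_inject is_max_def using ij by auto
    have mn: "(is_min p (\<lambda>k. b k j) i \<and> is_min q (a i) j) \<longleftrightarrow>
        (\<forall>u. grid_adj (Suc p) (Suc q) ?v u \<longrightarrow> c u = c ?v + step True)"
      unfolding iff[of "\<lambda>y. y = c ?v + step True"] add_left_cancel step_inject is_min_def using ij by auto
    have v: "?v \<in> grid_verts (Suc p) (Suc q)" using ij by (auto simp: grid_verts_iff)
    obtain u0 where u0: "grid_adj (Suc p) (Suc q) ?v u0" using ex_adj[OF pq v] .
    have pm: "\<exists>x. c u = c ?v + step x" if "grid_adj (Suc p) (Suc q) ?v u" for u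
      using iff[of "\<lambda>y. \<exists>x. y = c ?v + step x"] that by blast
    obtain x where x: "c u0 = c ?v + step x" using pm[OF u0] by blast
    show ?thesis
    proof
      assume "extremal p q a b i j"
      then obtain y where "\<forall>u. grid_adj (Suc p) (Suc q) ?v u \<longrightarrow> c u = c ?v + step y"
        unfolding extremal_def mx mn by blast
      then have "c u = c u'" if "grid_adj (Suc p) (Suc q) ?v u" "grid_adj (Suc p) (Suc q) ?v u'" for u u'
        using that by metis
      then show "?v \<in> flippable (Suc p) (Suc q) c" using v unfolding flippable_def by blast
    next
      assume "?v \<in> flippable (Suc p) (Suc q) c"
      then have *: "\<forall>u. grid_adj (Suc p) (Suc q) ?v u \<longrightarrow> c u = c ?v + step x"
        using flippableD[OF _ _ u0] x by metis
      show "extremal p q a b i j"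
        unfolding extremal_def mx mn using * by (cases x) (simp_all only: simp_thms, blast+)
    qed
  qed
  have "bij_betw (\<lambda>(i, j). (Suc i, Suc j)) {(i, j). i \<le> p \<and> j \<le> q \<and> extremal p q a b i j} (flippable (Suc p) (Suc q) c)"
    unfolding bij_betw_def
  proof
    show "(\<lambda>(i, j). (Suc i, Suc j)) ` {(i, j). i \<le> p \<and> j \<le> q \<and> extremal p q a b i j} = flippable (Suc p) (Suc q) c"
    proof (intro equalityI subsetI)
      fix v assume v: "v \<in> flippable (Suc p) (Suc q) c"
      then obtain i j where ij: "v = (Suc i, Suc j)" "i \<le> p" "j \<le> q" by (auto simp: flippable_def grid_verts_iff)
      then show "v \<in> (\<lambda>(i, j). (Suc i, Suc j)) ` {(i, j). i \<le> p \<and> j \<le> q \<and> extremal p q a b i j}"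
        using v key[of i j] by (intro image_eqI[of _ _ "(i, j)"]) auto
    qed (use key in auto)
  qed (auto simp: inj_on_def)
  then show ?thesis unfolding num_ext_def by (rule bij_betw_same_card[symmetric])
qed

text \<open>A vertex untouched by two flips shows that a rotation relating the results is
  trivial.\<close>

lemma third_vertex:
  assumes "0 < p" "0 < q"
  obtains w where "w \<in> grid_verts (Suc p) (Suc q)" "w \<noteq> v" "w \<noteq> v'"
proof -
  have "(1, 1) \<in> grid_verts (Suc p) (Suc q)" "(1, 2) \<in> grid_verts (Suc p) (Suc q)" "(2, 1) \<in> grid_verts (Suc p) (Suc q)"
    using assms by (auto simp: grid_verts_def)
  then show thesis using that[of "(1, 1)"] that[of "(1, 2)"] that[of "(2, 1)"]
    by (cases v; cases v') (metis Pair_inject numeral_eq_one_iff semiring_norm(85) one_neq_zero)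
qed

text \<open>The neighbouring orbits are those of the flips of \<open>c\<close>. Different flips give
  different orbits, since a rotation between them would fix the colour of an untouched
  vertex.\<close>

lemma degree_flippable:
  assumes c: "c \<in> proper_colourings (Suc p) (Suc q)" and pq: "0 < p" "0 < q"
  shows "OFG_degree (Suc p) (Suc q) (rotation_orbit (Suc p) (Suc q) c) = card (flippable (Suc p) (Suc q) c)"
proof -
  let ?m = "Suc p" and ?n = "Suc q"
  let ?O = "rotation_orbit ?m ?n" and ?F = "flippable ?m ?n c"
  have ext: "d v = undefined" if "d \<in> proper_colourings ?m ?n" "v \<notin> grid_verts ?m ?n" for d v
    using that by (rule proper_outside)
  have flip: "flip ?m ?n c v \<in> proper_colourings ?m ?n \<and> flip ?m ?n c v v \<noteq> c v" if v: "v \<in> ?F" for v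
  proof -
    have vg: "v \<in> grid_verts ?m ?n" using v by (auto simp: flippable_def)
    have P: "grid_adj ?m ?n u w \<Longrightarrow> c u \<noteq> c w" for u w using proper_neq[OF c] .
    obtain u where u: "grid_adj ?m ?n v u" using ex_adj[OF pq vg] .
    note eq = flip_third[OF v u]
    have new: "flip ?m ?n c v v \<noteq> c w" if "grid_adj ?m ?n v w" for w
      unfolding flip_third[OF v that] using third_colour(2)[OF P[OF that]] by simp
    have "flip ?m ?n c v u' \<noteq> flip ?m ?n c v w" if "grid_adj ?m ?n u' w" for u' w
      using that P[OF that] new[of w] new[of u'] grid_adj_sym[OF that] grid_adj_verts[OF that]
      by (cases "u' = v"; cases "w = v") (auto simp: eq)
    then have "flip ?m ?n c v \<in> proper_colourings ?m ?n"
      using vg proper_outside[OF c] by (intro proper_colouringsI) (auto simp: eq)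
    moreover have "flip ?m ?n c v v \<noteq> c v" unfolding eq using third_colour(1)[OF P[OF u]] by simp
    ultimately show ?thesis by blast
  qed
  have off: "flip ?m ?n c v w = c w" if "w \<noteq> v" for v w using that by (simp add: flip_def)
  have nbrs: "{B. OFG_adj ?m ?n (?O c) B} = (\<lambda>v. ?O (flip ?m ?n c v)) ` ?F"
  proof (intro equalityI subsetI)
    fix B assume "B \<in> {B. OFG_adj ?m ?n (?O c) B}"
    then obtain c' d where B: "B \<in> OFG_verts ?m ?n" and c': "c' \<in> ?O c" and d: "d \<in> B"
      and ex1: "\<exists>!v. v \<in> grid_verts ?m ?n \<and> c' v \<noteq> d v"
      by (auto simp: OFG_adj_def)
    obtain d0 where d0: "d0 \<in> proper_colourings ?m ?n" "B = ?O d0" using B by (auto simp: OFG_verts_def)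
    obtain k where k: "c' = rotate_colouring ?m ?n k c" using c' by (auto simp: rotation_orbit_def)
    have dp: "d \<in> proper_colourings ?m ?n" using d d0 rotate_proper by (auto simp: rotation_orbit_def)
    have BO: "B = ?O d" using d d0 orbit_eqI by blast
    \<comment> \<open>Adjacency supplies some representative of the orbit of \<open>c\<close>;
      rotating back by \<open>k\<close> allows a comparison with \<open>c\<close> itself.\<close>
    define d' where "d' = rotate_colouring ?m ?n (- k) d"
    have d'p: "d' \<in> proper_colourings ?m ?n" using dp by (simp add: d'_def rotate_proper)
    have BO': "B = ?O d'" by (simp add: d'_def orbit_rotate BO)
    obtain v where v: "v \<in> grid_verts ?m ?n" "c' v \<noteq> d v"
      and vu: "\<And>w. w \<in> grid_verts ?m ?n \<Longrightarrow> c' w \<noteq> d w \<Longrightarrow> w = v" using ex1 by blast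
    have dv: "d' v \<noteq> c v"
    proof
      assume "d' v = c v"
      then have "d v - k + k = c v + k" using v(1) by (simp add: d'_def rotate_apply)
      then show False using v by (simp add: k rotate_apply)
    qed
    have dw: "d' w = c w" if "w \<noteq> v" for w
    proof (cases "w \<in> grid_verts ?m ?n")
      case True
      then have "c' w = d w" using vu that by blast
      then have "d w = c w + k" using True by (simp add: k rotate_apply)
      then show ?thesis using True by (simp add: d'_def rotate_apply)
    next
      case False
      then show ?thesis using ext[OF c] ext[OF d'p] by simp
    qed
    \<comment> \<open>The new colour of \<open>v\<close> avoids its old colour and that of every
      neighbour, so it is the third colour relative to each of them; this forces the neighbours to
      agree.\<close>
    have nb: "d' v = - c v - c u" if "grid_adj ?m ?n v u" for u
    proof (rule third_colour(3))
      show "c v \<noteq> c u" using proper_neq[OF c that] .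
      show "d' v \<noteq> c v" by (rule dv)
      have "d' v \<noteq> d' u" using proper_neq[OF d'p that] .
      then show "d' v \<noteq> c u" using dw[of u] grid_adj_verts[OF that] by auto
    qed
    have "c u = c u'" if "grid_adj ?m ?n v u" "grid_adj ?m ?n v u'" for u u'
      using nb[OF that(1)] nb[OF that(2)] by simp
    then have vF: "v \<in> ?F" using v by (auto simp: flippable_def)
    obtain u where u: "grid_adj ?m ?n v u" using ex_adj[OF pq v(1)] .
    have "d' = flip ?m ?n c v"
      unfolding flip_third[OF vF u] using nb[OF u] dw by auto
    then show "B \<in> (\<lambda>v. ?O (flip ?m ?n c v)) ` ?F" using vF BO' by blast
  next
    fix B assume "B \<in> (\<lambda>v. ?O (flip ?m ?n c v)) ` ?F"
    then obtain v where v: "v \<in> ?F" and B: "B = ?O (flip ?m ?n c v)" by blast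
    have vg: "v \<in> grid_verts ?m ?n" using v by (auto simp: flippable_def)
    have ne: "?O c \<noteq> B"
    proof
      assume "?O c = B"
      then have "flip ?m ?n c v \<in> ?O c" using B self_in_orbit flip[OF v] by blast
      then obtain k where k: "flip ?m ?n c v = rotate_colouring ?m ?n k c" by (auto simp: rotation_orbit_def)
      obtain w where w: "w \<in> grid_verts ?m ?n" "w \<noteq> v" using third_vertex[OF pq] by metis
      have "c w = c w + k" using off[OF w(2)] k rotate_apply[OF w(1)] by metis
      then have "flip ?m ?n c v v = c v" using k rotate_apply[OF vg, of k c] by simp
      then show False using flip[OF v] by blast
    qed
    have "\<exists>!w. w \<in> grid_verts ?m ?n \<and> c w \<noteq> flip ?m ?n c v w"
      using vg flip[OF v] off by (intro ex1I[of _ v]) metis+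
    moreover have "c \<in> ?O c" "flip ?m ?n c v \<in> B" using B self_in_orbit flip[OF v] c by blast+
    ultimately have "\<exists>c\<in>?O c. \<exists>d\<in>B. \<exists>!v. v \<in> grid_verts ?m ?n \<and> c v \<noteq> d v" by blast
    then show "B \<in> {B. OFG_adj ?m ?n (?O c) B}"
      using ne c flip[OF v] B by (auto simp: OFG_adj_def OFG_verts_def)
  qed
  have "inj_on (\<lambda>v. ?O (flip ?m ?n c v)) ?F"
  proof (rule inj_onI, rule ccontr)
    fix v v' assume v: "v \<in> ?F" "v' \<in> ?F" and eq: "?O (flip ?m ?n c v) = ?O (flip ?m ?n c v')" and "v \<noteq> v'"
    have vg: "v \<in> grid_verts ?m ?n" using v by (auto simp: flippable_def)
    have "flip ?m ?n c v' \<in> ?O (flip ?m ?n c v)" using eq self_in_orbit flip[OF v(2)] by blast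
    then obtain k where k: "flip ?m ?n c v' = rotate_colouring ?m ?n k (flip ?m ?n c v)" by (auto simp: rotation_orbit_def)
    obtain w where w: "w \<in> grid_verts ?m ?n" "w \<noteq> v" "w \<noteq> v'" using third_vertex[OF pq] .
    have "c w = c w + k" using off[OF w(2)] off[OF w(3)] k rotate_apply[OF w(1)] by metis
    then have "flip ?m ?n c v' v = flip ?m ?n c v v" using k rotate_apply[OF vg, of k "flip ?m ?n c v"] by simp
    then show False using flip[OF v(1)] off[OF \<open>v \<noteq> v'\<close>] by simp
  qed
  then show ?thesis by (simp add: OFG_degree_def nbrs card_image)
qed

text \<open>\<open>conf_of\<close> is constant on orbits and inverts the passage from a pattern to
  the orbit of its colouring.\<close>

lemma card_OFG_degree:
  assumes pq: "0 < p" "0 < q"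
  shows "card {A \<in> OFG_verts (Suc p) (Suc q). OFG_degree (Suc p) (Suc q) A = k} =
    card {(a, b) \<in> confs p q. num_ext p q a b = k}"
proof -
  let ?m = "Suc p" and ?n = "Suc q"
  let ?f = "\<lambda>x. rotation_orbit ?m ?n (colouring_of p q x)"
  have deg: "OFG_degree ?m ?n (rotation_orbit ?m ?n c) = num_ext p q a b"
    if "c \<in> proper_colourings ?m ?n" "conf_of p q c = (a, b)" for c a b
    using degree_flippable[OF that(1) pq] card_flippable[OF that pq] by simp
  have "bij_betw ?f {(a, b) \<in> confs p q. num_ext p q a b = k} {A \<in> OFG_verts ?m ?n. OFG_degree ?m ?n A = k}"
    unfolding bij_betw_def
  proof (intro conjI equalityI subsetI)
    show "inj_on ?f {(a, b) \<in> confs p q. num_ext p q a b = k}"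
    proof (rule inj_onI)
      fix x y assume "x \<in> {(a, b) \<in> confs p q. num_ext p q a b = k}" "y \<in> {(a, b) \<in> confs p q. num_ext p q a b = k}"
        and eq: "?f x = ?f y"
      then have xy: "x \<in> confs p q" "y \<in> confs p q" by auto
      have "colouring_of p q y \<in> ?f x" using eq self_in_orbit colouring_of_proper[OF xy(2)] by blast
      then have "conf_of p q (colouring_of p q y) = conf_of p q (colouring_of p q x)"
        by (auto simp: rotation_orbit_def conf_of_rotate)
      then show "x = y" using xy by (simp add: conf_of_colouring_of)
    qed
  next
    fix A assume "A \<in> ?f ` {(a, b) \<in> confs p q. num_ext p q a b = k}"
    then obtain a b where ab: "(a, b) \<in> confs p q" "num_ext p q a b = k" "A = ?f (a, b)" by auto
    then show "A \<in> {A \<in> OFG_verts ?m ?n. OFG_degree ?m ?n A = k}"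
      using deg[OF colouring_of_proper conf_of_colouring_of, OF ab(1) ab(1)] colouring_of_proper[OF ab(1)]
      by (auto simp: OFG_verts_def)
  next
    fix A assume "A \<in> {A \<in> OFG_verts ?m ?n. OFG_degree ?m ?n A = k}"
    then obtain c where c: "c \<in> proper_colourings ?m ?n" "A = rotation_orbit ?m ?n c" "OFG_degree ?m ?n A = k"
      by (auto simp: OFG_verts_def)
    obtain a b where ab: "conf_of p q c = (a, b)" by (cases "conf_of p q c")
    then have in_confs: "(a, b) \<in> confs p q" using conf_of_in_confs[OF c(1)] by simp
    have "colouring_of p q (a, b) \<in> rotation_orbit ?m ?n c"
      by (rule same_conf_orbit[OF c(1) colouring_of_proper[OF in_confs]])
        (simp add: conf_of_colouring_of[OF in_confs] ab)
    then have "?f (a, b) = A" using c(2) orbit_eqI by blast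
    moreover have "num_ext p q a b = k" using deg[OF c(1) ab] c by simp
    ultimately show "A \<in> ?f ` {(a, b) \<in> confs p q. num_ext p q a b = k}" using in_confs by blast
  qed
  then show ?thesis using bij_betw_same_card by fastforce
qed

section \<open>The polynomial form of the count\<close>

lemma two_choose_2: "2 * real (Suc k choose 2) = (real k + 1) * real k"
  by (induction k) (simp_all add: numeral_2_eq_2 algebra_simps)

lemma six_choose_3: "6 * real (Suc (Suc k) choose 3) = (real k + 2) * (real k + 1) * real k"
proof (induction k)
  case (Suc k)
  have "Suc (Suc (Suc k)) choose 3 = (Suc (Suc k) choose 2) + (Suc (Suc k) choose 3)"
    by (simp add: numeral_eq_Suc)
  with Suc two_choose_2[of "Suc k"] show ?case by (simp add: algebra_simps)
qed (simp add: numeral_eq_Suc)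

theorem theorem3p12:
  fixes m n :: nat
  assumes "min m n \<ge> 4"
  shows "real (card {A \<in> OFG_verts m n. OFG_degree m n A = 5}) =
    1 / 3 * (2 * real m ^ 3 + 2 * real n ^ 3 + 6 * real m ^ 2 + 6 * real n ^ 2
      + 150 * real m * real n - 392 * real m - 392 * real n + 792)"
proof -
  \<comment> \<open>With \<open>m = P + 4\<close> and \<open>n = Q + 4\<close> the count contains no
    truncated subtraction when it is passed to the reals.\<close>
  define P Q where "P = m - 4" and "Q = n - 4"
  have mn: "m = Suc (P + 3)" "n = Suc (Q + 3)" using assms by (auto simp: P_def Q_def)
  have "card {A \<in> OFG_verts m n. OFG_degree m n A = 5} = card {(a, b) \<in> confs (P + 3) (Q + 3). num_ext (P + 3) (Q + 3) a b = 5}"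
    unfolding mn by (rule card_OFG_degree) simp_all
  also have "\<dots> = 4 * (Suc (Suc P) choose 3) + 4 * (Suc (Suc Q) choose 3) + 2 * (P + 2) * (Q + 2) +
    2 * (20 * (P + 1) * (Q + 1) + 16 * (P + 1) + 16 * (Q + 1) + 4 + 8 * (Suc P choose 2) + 8 * (Suc Q choose 2)) +
    4 * (2 * P * Q + 8 * P + 8 * Q + 12)"
    by (subst card_confs_5) (simp_all add: numeral_eq_Suc)
  finally show ?thesis
    using six_choose_3[of P] six_choose_3[of Q] two_choose_2[of P] two_choose_2[of Q]
    by (simp add: mn power2_eq_square power3_eq_cube field_simps)
qed

end
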